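(* Let $w\in S_n$. If $D_1$ and $D_2$ are reduced pipe dreams for $w$, then $$D_1\le D_2 \iff \mathbf{T}(D_1)\trianglelefteq \mathbf{T}(D_2),$$ where $\le$ is the order on $\mathrm{RPD}(w)$ generated by generalized ladder moves and $\trianglelefteq$ is the entrywise order on pipe dream tableaux.
   Context: A pipe dream is a finite subset $D\subset \mathbb{Z}_{>0}\times\mathbb{Z}_{>0}$, in matrix coordinates ($(i,j)$ is row $i$ from the top, column $j$ from the left). Place a cross tile at each $(i,j)\in D$ (one strand joins the left and right edges, the other joins the top and bottom edges) and a bump tile at each $(i,j)\notin D$ (one strand joins the top edge to the left edge, the other joins the right edge to the bottom edge). Write $D(i,j)=+$ if $(i,j)\in D$ and $D(i,j)=\bullet$ otherwise. The strands form pipes going from the top boundary to the left boundary; pipe $x$ is the one entering at the top of column $x$. The permutation $w$ of $D$ is defined by: $w(i)$ is the label of the pipe that exits the left boundary in row $i$. Permutations $w\in S_n$ are regarded as permutations of $\mathbb{Z}_{>0}$ fixing all $m>n$. $\mathrm{RPD}(w)$ is the set of reduced pipe dreams for $w$: pipe dreams $D$ whose permutation is $w$ and such that $|D|$ equals the number of inversions of $w$. Generalized ladder move: let $D\in\mathrm{RPD}(w)$, and suppose there are $h<i$ and $j<k$ such that $D(i,j)=+$, $D(h,j)=D(i,k)=D(h,k)=\bullet$, and every other tile in $[h,i]\times[j,k]$ is a $+$. Then $(i,j)$ is called ladder movable in $D$, and $\mathcal{L}_{ij}(D)\in\mathrm{RPD}(w)$ is obtained from $D$ by swapping the tiles at $(i,j)$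 and $(h,k)$ (given $(i,j)$, the pair $(h,k)$ is unique). Order: $D\le D'$ in $\mathrm{RPD}(w)$ iff $D'$ can be obtained from $D$ by a (possibly empty) sequence of generalized ladder moves. Pipe dream tableau: $\mathrm{Inv}(w^{-1})=\{(x,y): x<y,\ w^{-1}(x)>w^{-1}(y)\}$. In any $D\in\mathrm{RPD}(w)$, pipes $x<y$ cross iff $(x,y)\in\mathrm{Inv}(w^{-1})$, in which case they cross exactly once, pipe $x$ passing vertically and pipe $y$ horizontally. A left bump of pipe $x$ is a bump tile in which pipe $x$ is the strand joining the top edge to the left edge. For $(x,y)\in\mathrm{Inv}(w^{-1})$ let $\mathbf{T}_D(x,y)$ be the number of left bumps of pipe $x$ lying in rows strictly south of the crossing between pipes $x$ and $y$ in $D$. The pipe dream tableau $\mathbf{T}(D)$ is the filling of the Rothe diagram $\{(i,w(j)): i<j,\ w(i)>w(j)\}$ of $w$ with entry $\mathbf{T}_D(x,y)$ in cell $(w^{-1}(y),x)$. Put $\mathbf{T}(D_1)\trianglelefteq\mathbf{T}(D_2)$ iff $\mathbf{T}_{D_1}(x,y)\le\mathbf{T}_{D_2}(x,y)$ for all $(x,y)\in\mathrm{Inv}(w^{-1})$. *)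

theory Defs
  imports "HOL-Combinatorics.Permutations" "HOL-Library.FuncSet"
begin

text \<open>
  Cells are pairs (row, column) in matrix coordinates, both counted from 1.  A pipe dream is
  identified with its set of cross tiles; all other cells carry bump tiles.
\<close>

type_synonym cell = "nat \<times> nat"

definition pipe_dream :: "cell set \<Rightarrow> bool" where
  "pipe_dream D \<longleftrightarrow> finite D \<and> D \<subseteq> {1..} \<times> {1..}"

datatype edge = Top_Edge | Right_Edge

text \<open>
  \<open>enters D x e (i, j)\<close>: following pipe \<open>x\<close> from the top boundary towards the left boundary, it
  enters the tile \<open>(i, j)\<close> through the edge \<open>e\<close> of that tile.  Leaving a tile through its bottom
  (left) edge means entering the tile below (to the left) through its top (right) edge.
  Column 0 is not part of the grid: entering \<open>(i, 0)\<close> means having left the grid through the left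
  boundary in row \<open>i\<close>, and the pipe is not continued from there.
\<close>

inductive enters :: "cell set \<Rightarrow> nat \<Rightarrow> edge \<Rightarrow> cell \<Rightarrow> bool" for D x where
  start: "1 \<le> x \<Longrightarrow> enters D x Top_Edge (1, x)"
| cross_vertical: "enters D x Top_Edge (i, j) \<Longrightarrow> 1 \<le> j \<Longrightarrow> (i, j) \<in> D
    \<Longrightarrow> enters D x Top_Edge (i + 1, j)"
| cross_horizontal: "enters D x Right_Edge (i, j) \<Longrightarrow> 1 \<le> j \<Longrightarrow> (i, j) \<in> D
    \<Longrightarrow> enters D x Right_Edge (i, j - 1)"
| bump_top_left: "enters D x Top_Edge (i, j) \<Longrightarrow> 1 \<le> j \<Longrightarrow> (i, j) \<notin> D
    \<Longrightarrow> enters D x Right_Edge (i, j - 1)"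
| bump_right_bottom: "enters D x Right_Edge (i, j) \<Longrightarrow> 1 \<le> j \<Longrightarrow> (i, j) \<notin> D
    \<Longrightarrow> enters D x Top_Edge (i + 1, j)"

definition exits_in_row :: "cell set \<Rightarrow> nat \<Rightarrow> nat \<Rightarrow> bool" where
  "exits_in_row D x i \<longleftrightarrow> enters D x Right_Edge (i, 0)"

text \<open>
  Permutations of the positive integers are functions on \<^typ>\<open>nat\<close>; the value at 0 is irrelevant
  here, and it is 0 for every \<open>w\<close> with \<open>w permutes {1..n}\<close>.
\<close>

definition has_permutation :: "cell set \<Rightarrow> (nat \<Rightarrow> nat) \<Rightarrow> bool" where
  "has_permutation D w \<longleftrightarrow> (\<forall>i\<ge>1. exits_in_row D (w i) i)"

definition inversions :: "(nat \<Rightarrow> nat) \<Rightarrow> (nat \<times> nat) set" where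
  "inversions w = {(x, y). 1 \<le> x \<and> x < y \<and> w x > w y}"

definition RPD :: "(nat \<Rightarrow> nat) \<Rightarrow> cell set set" where
  "RPD w = {D. pipe_dream D \<and> has_permutation D w \<and> card D = card (inversions w)}"

definition ladder_move :: "(nat \<Rightarrow> nat) \<Rightarrow> cell set \<Rightarrow> cell set \<Rightarrow> bool" where
  "ladder_move w D D' \<longleftrightarrow> D \<in> RPD w \<and>
     (\<exists>h i j k. 1 \<le> h \<and> h < i \<and> 1 \<le> j \<and> j < k \<and>
        (i, j) \<in> D \<and> (h, j) \<notin> D \<and> (i, k) \<notin> D \<and> (h, k) \<notin> D \<and>
        {h..i} \<times> {j..k} - {(i, j), (h, j), (i, k), (h, k)} \<subseteq> D \<and>
        D' = insert (h, k) (D - {(i, j)}))"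

definition ladder_le :: "(nat \<Rightarrow> nat) \<Rightarrow> cell set \<Rightarrow> cell set \<Rightarrow> bool" where
  "ladder_le w = (ladder_move w)\<^sup>*\<^sup>*"

definition crosses_at :: "cell set \<Rightarrow> nat \<Rightarrow> nat \<Rightarrow> cell \<Rightarrow> bool" where
  "crosses_at D x y p \<longleftrightarrow> p \<in> D \<and>
     (enters D x Top_Edge p \<and> enters D y Right_Edge p \<or>
      enters D y Top_Edge p \<and> enters D x Right_Edge p)"

text \<open>
  Meaningful when the two pipes cross exactly once, as they do for \<open>D \<in> RPD w\<close> and
  \<open>(x, y) \<in> inversions (inv w)\<close>.
\<close>

definition crossing :: "cell set \<Rightarrow> nat \<Rightarrow> nat \<Rightarrow> cell" where
  "crossing D x y = (THE p. crosses_at D x y p)"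

definition left_bumps :: "cell set \<Rightarrow> nat \<Rightarrow> cell set" where
  "left_bumps D x = {(i, j). 1 \<le> j \<and> (i, j) \<notin> D \<and> enters D x Top_Edge (i, j)}"

definition bumps_below :: "cell set \<Rightarrow> nat \<Rightarrow> nat \<Rightarrow> nat" where
  "bumps_below D x y = card {p \<in> left_bumps D x. fst p > fst (crossing D x y)}"

definition rothe_diagram :: "(nat \<Rightarrow> nat) \<Rightarrow> cell set" where
  "rothe_diagram w = {(i, w j) | i j. 1 \<le> i \<and> i < j \<and> w i > w j}"

text \<open>
  The cell \<open>(r, x)\<close> of the Rothe diagram is \<open>(inv w y, x)\<close> for \<open>y = w r\<close>.  The pipe dream tableau
  is a filling of the Rothe diagram, so it is \<^const>\<open>undefined\<close> on all other cells.
\<close>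

definition pd_tableau :: "(nat \<Rightarrow> nat) \<Rightarrow> cell set \<Rightarrow> cell \<Rightarrow> nat" where
  "pd_tableau w D = (\<lambda>(r, x)\<in>rothe_diagram w. bumps_below D x (w r))"

definition tableau_le :: "(nat \<Rightarrow> nat) \<Rightarrow> (cell \<Rightarrow> nat) \<Rightarrow> (cell \<Rightarrow> nat) \<Rightarrow> bool" where
  "tableau_le w T1 T2 \<longleftrightarrow> (\<forall>(x, y)\<in>inversions (inv w). T1 (inv w y, x) \<le> T2 (inv w y, x))"

lemma pd_tableau_entry:
  assumes w: "w permutes {1..n}" and xy: "(x, y) \<in> inversions (inv w)"
  shows "pd_tableau w D (inv w y, x) = bumps_below D x y"
proof -
  have xy': "1 \<le> x" "x < y" "inv w y < inv w x"
    using xy by (auto simp: inversions_def)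
  have inv: "w (inv w z) = z" for z
    using permutes_inverses(1)[OF w] .
  have "w 0 = 0"
    using w by (simp add: permutes_def)
  then have "inv w y \<noteq> 0"
    using inv[of y] xy' by (metis not_less_zero)
  then have "(inv w y, w (inv w x)) \<in> rothe_diagram w"
    unfolding rothe_diagram_def using xy' by (auto simp: inv intro!: exI[of _ "inv w x"])
  then show ?thesis
    by (simp add: pd_tableau_def inv)
qed

end

theory Submission
  imports Defs
begin

text \<open>
  A ladder move swaps two pipes along a full rectangle.  It moves one left bump of one of them, \<open>P\<close>,
  down to the bottom row, and the only entries it changes are raised by 1: those for \<open>P\<close> and the
  pipes it crosses, after the move, on the right edge of the rectangle.  Hence ladder moves increase
  the tableau.

  Conversely suppose \<open>T(D\<^sub>1) \<le> T(D\<^sub>2)\<close> and \<open>D\<^sub>1 \<noteq> D\<^sub>2\<close>.  The total number of left bumps of a pipe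
  depends only on \<open>w\<close>, so a pipe crosses vertically in the first row iff one of its entries is
  maximal.  Therefore in the first row where they differ the crosses of \<open>D\<^sub>1\<close> form a proper subset of
  those of \<open>D\<^sub>2\<close>.  Starting from the leftmost cross of \<open>D\<^sub>2\<close> missing from \<open>D\<^sub>1\<close>, one finds an inverse
  ladder move on \<open>D\<^sub>2\<close> whose result still dominates \<open>D\<^sub>1\<close>; it moves a cross to the left, so this
  process ends, and it can only end in \<open>D\<^sub>1\<close>.
\<close>

section \<open>Pipe labels\<close>

text \<open>A pipe meeting the right edge of \<open>(i, j)\<close> has run through crosses from the
  next bump on the right, whose column therefore identifies it. Finiteness of \<open>D\<close>
  guarantees that such a bump exists.\<close>

definition next_bump :: "cell set \<Rightarrow> nat \<Rightarrow> nat \<Rightarrow> nat" where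
  "next_bump D i j = (LEAST d. j < d \<and> (i, d) \<notin> D)"

text \<open>
  The column in which the pipe leaving \<open>(i, j)\<close> through the bottom edge enters row \<open>i\<close> from the top.
\<close>

definition source :: "cell set \<Rightarrow> nat \<Rightarrow> nat \<Rightarrow> nat" where
  "source D i j = (if (i, j) \<in> D then j else next_bump D i j)"

text \<open>
  \<open>pipe_top D i j\<close> is the pipe entering \<open>(i, j)\<close> from the top; for \<open>j = 0\<close> and \<open>i \<ge> 2\<close> it is the pipe
  that exits in row \<open>i - 1\<close>.  Row 0 consists of bump tiles and shifts the labels by one column.
\<close>

fun pipe_top :: "cell set \<Rightarrow> nat \<Rightarrow> nat \<Rightarrow> nat" where
  "pipe_top D 0 j = j - 1"
| "pipe_top D (Suc i) j = pipe_top D i (source D i j)"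

definition pipe_right :: "cell set \<Rightarrow> nat \<Rightarrow> nat \<Rightarrow> nat" where
  "pipe_right D i j = pipe_top D i (next_bump D i j)"

lemma next_bump:
  assumes "finite D"
  shows "j < next_bump D i j" "(i, next_bump D i j) \<notin> D"
    and "\<And>d. j < d \<Longrightarrow> d < next_bump D i j \<Longrightarrow> (i, d) \<in> D"
proof -
  have "finite {d. (i, d) \<in> D}"
    using finite_imageI[OF assms, of snd] by (rule rev_finite_subset) force
  then have "finite ({..j} \<union> {d. (i, d) \<in> D})"
    by simp
  then obtain d where "d \<notin> {..j} \<union> {d. (i, d) \<in> D}"
    using ex_new_if_finite infinite_UNIV_nat by blast
  then have d: "j < d \<and> (i, d) \<notin> D"
    by auto
  show "j < next_bump D i j" "(i, next_bump D i j) \<notin> D"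
    using LeastI[of "\<lambda>d. j < d \<and> (i, d) \<notin> D", OF d] by (auto simp: next_bump_def)
  show "(i, d) \<in> D" if "j < d" "d < next_bump D i j" for d
    using not_less_Least[of d "\<lambda>d. j < d \<and> (i, d) \<notin> D"] that by (auto simp: next_bump_def)
qed

lemma next_bump_eqI:
  assumes "j < d" "(i, d) \<notin> D" "\<And>c. j < c \<Longrightarrow> c < d \<Longrightarrow> (i, c) \<in> D"
  shows "next_bump D i j = d"
  unfolding next_bump_def using assms by (intro Least_equality) (auto simp: not_less[symmetric])

lemma next_bump_skip:
  assumes "j \<le> j'" "\<And>c. j < c \<Longrightarrow> c \<le> j' \<Longrightarrow> (i, c) \<in> D" "finite D"
  shows "next_bump D i j = next_bump D i j'"
proof (rule next_bump_eqI)
  show "j < next_bump D i j'" "(i, next_bump D i j') \<notin> D"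
    using assms(1) next_bump(1,2)[OF assms(3), where i = i and j = j'] by simp_all
  show "(i, c) \<in> D" if "j < c" "c < next_bump D i j'" for c
    using assms(2)[of c] next_bump(3)[OF assms(3), where i = i and j = j' and d = c] that by (cases "c \<le> j'") auto
qed

text \<open>For \<open>a < b\<close> a common source is at least \<open>b\<close>, so it is the next
  bump after \<open>a\<close>. A bump at \<open>b\<close> would already stop that search at
  \<open>b\<close>, and a cross at \<open>b\<close> would itself be the source, hence not a
  bump.\<close>

lemma source_inj:
  assumes "finite D"
  shows "inj (source D i)"
proof -
  have *: False if "a < b" "source D i a = source D i b" for a b
    using next_bump(1,2)[OF assms, where i = i and j = b]
      next_bump(1,2)[OF assms, where i = i and j = a]
      next_bump(3)[OF assms, where i = i and j = a and d = b] that
    by (auto simp: source_def split: if_splits)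
  show ?thesis
    by (rule injI) (metis * linorder_neqE_nat)
qed

lemma pipe_dream_no_zero: "pipe_dream D \<Longrightarrow> (i, 0) \<notin> D \<and> (0, j) \<notin> D"
  by (auto simp: pipe_dream_def)

lemma pipe_dream_finite: "pipe_dream D \<Longrightarrow> finite D"
  by (simp add: pipe_dream_def)

lemma source_range:
  assumes "pipe_dream D"
  shows "range (source D i) = {1..}"
proof (intro equalityI subsetI)
  fix c assume "c \<in> range (source D i)"
  then obtain d where c: "c = source D i d" by auto
  show "c \<in> {1..}"
    using next_bump(1)[OF pipe_dream_finite[OF assms], of d i] pipe_dream_no_zero[OF assms, of i 0]
    by (cases d) (auto simp: c source_def)
next
  fix c :: nat assume "c \<in> {1..}"
  then have c: "1 \<le> c" by simp
  show "c \<in> range (source D i)"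
  proof (cases "(i, c) \<in> D")
    case True
    then show ?thesis
      by (auto simp: source_def intro!: image_eqI[of _ _ c])
  next
    case False
    \<comment> \<open>A bump is the source of the previous bump to its left; column 0 counts as a
      bump, so one always exists.\<close>
    define S where "S = {d. d < c \<and> (i, d) \<notin> D}"
    have "0 \<in> S"
      using c pipe_dream_no_zero[OF assms] by (simp add: S_def)
    then have S: "finite S" "S \<noteq> {}"
      by (auto simp: S_def)
    define d where "d = Max S"
    have d: "d < c" "(i, d) \<notin> D"
      using Max_in[OF S] by (auto simp: S_def d_def)
    have "(i, e) \<in> D" if "d < e" "e < c" for e
    proof -
      have "e \<notin> S"
        using Max_ge[OF S(1), of e] that(1) by (auto simp: d_def)
      then show ?thesis using that(2) by (simp add: S_def)
    qed
    then have "next_bump D i d = c"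
      using d False by (intro next_bump_eqI) auto
    then show ?thesis
      using d by (auto simp: source_def intro!: image_eqI[of _ _ d])
  qed
qed

lemma pipe_top_one: "pipe_dream D \<Longrightarrow> pipe_top D (Suc 0) j = j"
  using pipe_dream_no_zero[of D 0] next_bump_eqI[of j "Suc j" 0 D]
  by (auto simp: source_def)

text \<open>Row 0 is excluded because truncated subtraction gives its columns 0 and 1 the same
  label.\<close>

lemma pipe_top_inj:
  assumes "pipe_dream D" "1 \<le> i"
  shows "inj (pipe_top D i)"
  using assms(2)
proof (induction i rule: dec_induct)
  case base
  then show ?case using pipe_top_one[OF assms(1)] by (auto intro: injI)
next
  case (step i)
  have "pipe_top D (Suc i) = pipe_top D i \<circ> source D i" by auto
  then show ?case
    using step.IH source_inj[OF pipe_dream_finite[OF assms(1)]] by (metis inj_compose)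
qed

lemma pipe_top_eq_iff:
  "pipe_dream D \<Longrightarrow> 1 \<le> i \<Longrightarrow> pipe_top D i j = pipe_top D i k \<longleftrightarrow> j = k"
  using pipe_top_inj by (simp add: inj_eq)

text \<open>Column 0 is the only column that is no source: for \<open>i >= 2\<close> its label
  belongs to a pipe that has already exited.\<close>

lemma pipe_top_Suc_image:
  assumes "pipe_dream D"
  shows "range (pipe_top D (Suc i)) = pipe_top D i ` {1..}"
  using source_range[OF assms, of i] by (auto simp flip: image_image)

lemma pipe_top_Suc_cross: "(i, j) \<in> D \<Longrightarrow> pipe_top D (Suc i) j = pipe_top D i j"
  and pipe_top_Suc_bump: "(i, j) \<notin> D \<Longrightarrow> pipe_top D (Suc i) j = pipe_right D i j"
  by (simp_all add: source_def pipe_right_def)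

lemma pipe_top_column:
  assumes "i \<le> i'" "\<And>s. i \<le> s \<Longrightarrow> s < i' \<Longrightarrow> (s, j) \<in> D"
  shows "pipe_top D i' j = pipe_top D i j"
  using assms
proof (induction i' rule: dec_induct)
  case (step s)
  then have "pipe_top D s j = pipe_top D i j" "(s, j) \<in> D" by auto
  then show ?case using pipe_top_Suc_cross by metis
qed simp

section \<open>Agreement of the labels with the traced pipes\<close>

lemma enters_imp_label:
  assumes "pipe_dream D" "enters D x e p"
  shows "1 \<le> fst p \<and> (case e of
      Top_Edge \<Rightarrow> 1 \<le> snd p \<and> pipe_top D (fst p) (snd p) = x
    | Right_Edge \<Rightarrow> pipe_right D (fst p) (snd p) = x)"
  using assms(2)
proof induction
  case start
  then show ?case using pipe_top_one[OF assms(1)] by simp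
next
  case (cross_vertical i j)
  then show ?case using pipe_top_Suc_cross by simp
next
  case (cross_horizontal i j)
  then have "next_bump D i (j - 1) = next_bump D i j"
    using pipe_dream_finite[OF assms(1)]
    by (intro next_bump_skip) (auto dest: le_antisym simp: less_eq_Suc_le)
  then show ?case using cross_horizontal by (simp add: pipe_right_def)
next
  case (bump_top_left i j)
  then have "next_bump D i (j - 1) = j"
    by (intro next_bump_eqI) auto
  then show ?case using bump_top_left by (simp add: pipe_right_def)
next
  case (bump_right_bottom i j)
  then show ?case using pipe_top_Suc_bump by simp
qed

lemma enters_row:
  assumes "pipe_dream D" "\<And>j. 1 \<le> j \<Longrightarrow> enters D (pipe_top D i j) Top_Edge (i, j)"
  shows "enters D (pipe_right D i j) Right_Edge (i, j)"
proof -
  define d where "d = next_bump D i j"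
  note d = next_bump[OF pipe_dream_finite[OF assms(1)], where i = i and j = j, folded d_def]
  \<comment> \<open>Induction leftwards from the bump in column \<open>d\<close>: its strand leaves
    to the left and passes horizontally through the crosses down to column \<open>j\<close>.\<close>
  have "d - 1 \<ge> c \<Longrightarrow> j \<le> c \<Longrightarrow> enters D (pipe_top D i d) Right_Edge (i, c)" for c
  proof (induction c rule: inc_induct)
    case base
    then show ?case using assms(2)[of d] d enters.bump_top_left by simp
  next
    case (step c)
    then have "(i, Suc c) \<in> D" using d(3) by auto
    then show ?case
      using step enters.cross_horizontal[of D _ i "Suc c"] by simp
  qed
  then show ?thesis using d by (simp add: pipe_right_def d_def)
qed

lemma enters_label:
  assumes "pipe_dream D" "1 \<le> i"
  shows "(1 \<le> j \<longrightarrow> enters D (pipe_top D i j) Top_Edge (i, j)) \<and>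
    enters D (pipe_right D i j) Right_Edge (i, j)"
  using assms(2)
proof (induction i arbitrary: j rule: dec_induct)
  case base
  have "enters D (pipe_top D 1 j) Top_Edge (1, j)" if "1 \<le> j" for j
    using enters.start[OF that] pipe_top_one[OF assms(1)] by simp
  then show ?case using enters_row[OF assms(1)] by blast
next
  case (step i)
  have "enters D (pipe_top D (Suc i) j) Top_Edge (Suc i, j)" if "1 \<le> j" for j
  proof (cases "(i, j) \<in> D")
    case True
    then show ?thesis
      using step.IH[of j] that enters.cross_vertical[of D _ i j] pipe_top_Suc_cross[OF True] by simp
  next
    case False
    then show ?thesis
      using step.IH[of j] that enters.bump_right_bottom[of D _ i j] pipe_top_Suc_bump[OF False] by simp
  qed
  then show ?case using enters_row[OF assms(1)] by blast
qed

lemma enters_top_iff: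
  assumes "pipe_dream D"
  shows "enters D x Top_Edge (i, j) \<longleftrightarrow> 1 \<le> i \<and> 1 \<le> j \<and> pipe_top D i j = x"
  using enters_imp_label[OF assms, of x Top_Edge "(i, j)"] enters_label[OF assms, of i j] by auto

lemma enters_right_iff:
  assumes "pipe_dream D"
  shows "enters D x Right_Edge (i, j) \<longleftrightarrow> 1 \<le> i \<and> pipe_right D i j = x"
  using enters_imp_label[OF assms, of x Right_Edge "(i, j)"] enters_label[OF assms, of i j] by auto

text \<open>Column 0 contains no cross, so the label below it is that of the pipe entering it from
  the right, the one that leaves the grid.\<close>

lemma has_permutation_iff:
  assumes "pipe_dream D"
  shows "has_permutation D w \<longleftrightarrow> (\<forall>i\<ge>1. pipe_top D (Suc i) 0 = w i)"
  using pipe_top_Suc_bump[of _ 0 D] pipe_dream_no_zero[OF assms]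
  by (auto simp: has_permutation_def exits_in_row_def enters_right_iff[OF assms])

lemma crosses_at_iff:
  assumes "pipe_dream D"
  shows "crosses_at D x y (i, j) \<longleftrightarrow> (i, j) \<in> D \<and>
    (pipe_top D i j = x \<and> pipe_right D i j = y \<or> pipe_top D i j = y \<and> pipe_right D i j = x)"
proof -
  have "1 \<le> i \<and> 1 \<le> j" if "(i, j) \<in> D"
    using assms that by (auto simp: pipe_dream_def)
  then show ?thesis
    by (auto simp: crosses_at_def enters_top_iff[OF assms] enters_right_iff[OF assms])
qed

section \<open>Crossings of reduced pipe dreams\<close>

text \<open>Pipe \<open>x\<close> starts left of pipe \<open>y\<close>. As long as \<open>y\<close>
  never passes \<open>x\<close> horizontally at a cross, \<open>x\<close> stays to the left in every
  row, which is absurd once \<open>y\<close> has reached column 0.\<close>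

lemma crossing_exists:
  assumes D: "pipe_dream D" and "1 \<le> x" "x < y"
    and y: "pipe_top D (Suc e) 0 = y" and x: "pipe_top D (Suc f) 0 = x" and e: "1 \<le> e" "e < f"
  shows "\<exists>i j. (i, j) \<in> D \<and> pipe_top D i j = x \<and> pipe_right D i j = y"
proof (rule ccontr)
  assume no: "\<not> ?thesis"
  note fin = pipe_dream_finite[OF D]
  have x_alive: "x \<in> pipe_top D i ` {1..}" if "i \<le> f" for i
    using that
  proof (induction i rule: inc_induct)
    case base
    then show ?case using x pipe_top_Suc_image[OF D, of f] by blast
  next
    case (step i)
    then show ?case using pipe_top_Suc_image[OF D, of i] by blast
  qed
  \<comment> \<open>Here the whole range is taken, since in row \<open>Suc e\<close> pipe
    \<open>y\<close> sits in column 0.\<close>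
  have y_alive: "y \<in> range (pipe_top D i)" if "i \<le> Suc e" for i
    using that
  proof (induction i rule: inc_induct)
    case base
    then show ?case using y by blast
  next
    case (step i)
    then show ?case using pipe_top_Suc_image[OF D, of i] by blast
  qed
  have "\<exists>c d. 1 \<le> c \<and> c < d \<and> pipe_top D i c = x \<and> pipe_top D i d = y"
    if "1 \<le> i" "i \<le> Suc e" for i
    using that
  proof (induction i rule: dec_induct)
    case base
    then show ?case using pipe_top_one[OF D] assms(2,3) by auto
  next
    case (step i)
    then obtain c d where cd: "1 \<le> c" "c < d" "pipe_top D i c = x" "pipe_top D i d = y"
      by auto
    obtain c' where c': "1 \<le> c'" "pipe_top D (Suc i) c' = x"
      using x_alive[of "Suc i"] step.prems e by auto
    obtain d' where d': "pipe_top D (Suc i) d' = y"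
      using y_alive[of "Suc i"] step.prems by auto
    have c: "source D i c' = c" and d: "source D i d' = d"
      using c' d' cd pipe_top_eq_iff[OF D step.hyps(1)] by auto
    \<comment> \<open>The order can flip only where \<open>y\<close> runs left over a cross that
      \<open>x\<close> passes vertically, which \<open>no\<close> forbids.\<close>
    have "c' < d'"
    proof (rule ccontr)
      assume "\<not> c' < d'"
      moreover have "c' \<noteq> d'"
        using c d cd(2) by auto
      ultimately have "d' < c'" by simp
      note nc = next_bump[OF fin, where i = i and j = c']
      note nd = next_bump[OF fin, where i = i and j = d']
      show False
      proof (cases "(i, d') \<in> D")
        case True
        then have "d' = d" using d by (simp add: source_def)
        then show False
          using \<open>d' < c'\<close> cd(2) c nc(1) by (simp add: source_def split: if_splits)
      next
        case d'_bump: False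
        then have d_eq: "d = next_bump D i d'" using d by (simp add: source_def)
        show False
        proof (cases "(i, c') \<in> D")
          case True
          then have "c' = c" using c by (simp add: source_def)
          have "next_bump D i d' = next_bump D i c"
            using \<open>d' < c'\<close> \<open>c' = c\<close> cd(2) nd(3) d_eq fin by (intro next_bump_skip) auto
          then have "pipe_right D i c = y"
            using d_eq cd(4) by (simp add: pipe_right_def)
          then show False
            using no True cd(3) \<open>c' = c\<close> by blast
        next
          case False
          then show False
            using nd(3)[of c'] \<open>d' < c'\<close> d_eq cd(2) c nc(1) by (auto simp: source_def)
        qed
      qed
    qed
    then show ?case using c' d' by blast
  qed
  from this[of "Suc e"] obtain c d where "c < d" "pipe_top D (Suc e) d = y" by auto
  then show False
    using y pipe_top_eq_iff[OF D, of "Suc e" d 0] by auto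
qed

lemma permutes_pos:
  assumes "w permutes {1..n::nat}" "1 \<le> x"
  shows "1 \<le> w x"
  using assms permutes_in_image[OF assms(1), of x] by (cases "x \<in> {1..n}") (auto simp: permutes_def)

lemma card_inversions_inv:
  assumes "w permutes {1..n}"
  shows "card (inversions (inv w)) = card (inversions w)"
proof (rule bij_betw_same_card)
  have [simp]: "w (inv w z) = z" "inv w (w z) = z" for z
    using permutes_inverses[OF assms] by auto
  show "bij_betw (\<lambda>(x, y). (inv w y, inv w x)) (inversions (inv w)) (inversions w)"
    using permutes_pos[OF assms] permutes_pos[OF permutes_inv[OF assms]]
    by (intro bij_betw_byWitness[of _ "\<lambda>(a, b). (w b, w a)"]) (fastforce simp: inversions_def)+
qed

text \<open>The vertical pipe comes first, so that at a cross of a reduced pipe dream the smaller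
  label does too.\<close>

definition pipe_pair :: "cell set \<Rightarrow> cell \<Rightarrow> nat \<times> nat" where
  "pipe_pair D = (\<lambda>(i, j). (pipe_top D i j, pipe_right D i j))"

lemma RPD_D:
  assumes "D \<in> RPD w"
  shows "pipe_dream D" "1 \<le> i \<Longrightarrow> pipe_top D (Suc i) 0 = w i"
  using assms has_permutation_iff by (auto simp: RPD_def)

text \<open>
  Every inversion forces a crossing of its two pipes; since there are as many crosses as inversions,
  there are no other crossings and none is repeated.
\<close>

lemma RPD_bij_betw:
  assumes w: "w permutes {1..n}" and D: "D \<in> RPD w"
  shows "bij_betw (pipe_pair D) D (inversions (inv w))"
proof -
  note pd = RPD_D(1)[OF D]
  have sub: "inversions (inv w) \<subseteq> pipe_pair D ` D"
  proof clarify
    fix x y assume "(x, y) \<in> inversions (inv w)"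
    then have xy: "1 \<le> x" "x < y" "inv w y < inv w x" by (auto simp: inversions_def)
    have "1 \<le> inv w y" "1 \<le> inv w x"
      using xy permutes_pos[OF permutes_inv[OF w]] by auto
    then have "pipe_top D (Suc (inv w y)) 0 = y" "pipe_top D (Suc (inv w x)) 0 = x"
      using RPD_D(2)[OF D] permutes_inverses(1)[OF w] by auto
    then obtain i j where "(i, j) \<in> D" "pipe_top D i j = x" "pipe_right D i j = y"
      using crossing_exists[OF pd xy(1,2)] xy(3) \<open>1 \<le> inv w y\<close> by blast
    then show "(x, y) \<in> pipe_pair D ` D"
      by (auto simp: pipe_pair_def intro!: image_eqI[of _ _ "(i, j)"])
  qed
  have card: "card D = card (inversions (inv w))"
    using D card_inversions_inv[OF w] by (simp add: RPD_def)
  have fin: "finite D" using pipe_dream_finite[OF pd] .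
  have card_img: "card (pipe_pair D ` D) = card D"
    using card_image_le[OF fin, of "pipe_pair D"] card_mono[OF finite_imageI[OF fin] sub] card
    by linarith
  have "inversions (inv w) = pipe_pair D ` D"
    by (rule card_subset_eq[OF finite_imageI[OF fin] sub]) (simp only: card_img card)
  then show ?thesis
    using eq_card_imp_inj_on[OF fin card_img] by (simp add: bij_betw_def)
qed

text \<open>\<open>crosses_at\<close> is symmetric in the two pipes, so injectivity of
  \<open>pipe_pair\<close> settles uniqueness only after the case of exchanged roles is excluded;
  there each label would be smaller than the other.\<close>

lemma RPD_crossing:
  assumes "w permutes {1..n}" "D \<in> RPD w" "(i, j) \<in> D"
  shows "(pipe_top D i j, pipe_right D i j) \<in> inversions (inv w)"
    and "crossing D (pipe_top D i j) (pipe_right D i j) = (i, j)"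
proof -
  note b = RPD_bij_betw[OF assms(1,2)]
  have pair: "pipe_pair D (i', j') \<in> inversions (inv w)" if "(i', j') \<in> D" for i' j'
    using bij_betwE[OF b] that by blast
  then show inv: "(pipe_top D i j, pipe_right D i j) \<in> inversions (inv w)"
    using assms(3) by (force simp: pipe_pair_def)
  show "crossing D (pipe_top D i j) (pipe_right D i j) = (i, j)"
    unfolding crossing_def
  proof (rule the_equality)
    show "crosses_at D (pipe_top D i j) (pipe_right D i j) (i, j)"
      using assms(3) by (simp add: crosses_at_iff[OF RPD_D(1)[OF assms(2)]])
    fix p assume p: "crosses_at D (pipe_top D i j) (pipe_right D i j) p"
    obtain i' j' where p_eq: "p = (i', j')" by force
    from p have "(i', j') \<in> D" "pipe_pair D (i', j') = pipe_pair D (i, j) \<or>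
        pipe_pair D (i', j') = prod.swap (pipe_pair D (i, j))"
      by (auto simp: p_eq crosses_at_iff[OF RPD_D(1)[OF assms(2)]] pipe_pair_def)
    moreover have "pipe_pair D (i', j') \<noteq> prod.swap (pipe_pair D (i, j))"
      using pair[of i' j'] pair[of i j] calculation(1) assms(3)
      by (auto simp: inversions_def pipe_pair_def)
    ultimately show "p = (i, j)"
      using bij_betw_imp_inj_on[OF b] assms(3) p_eq by (auto dest: inj_onD)
  qed
qed

lemma RPD_crossing_exists:
  assumes "w permutes {1..n}" "D \<in> RPD w" "(x, y) \<in> inversions (inv w)"
  obtains i j where "(i, j) \<in> D" "pipe_top D i j = x" "pipe_right D i j = y"
    "crossing D x y = (i, j)"
proof -
  have "(x, y) \<in> pipe_pair D ` D"
    using RPD_bij_betw[OF assms(1,2)] assms(3) by (simp add: bij_betw_def)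
  then obtain i j where "(i, j) \<in> D" "pipe_top D i j = x" "pipe_right D i j = y"
    by (auto simp: pipe_pair_def)
  then show ?thesis
    using that RPD_crossing(2)[OF assms(1,2)] by blast
qed

section \<open>Left bumps counted by rows\<close>

definition bump_rows :: "cell set \<Rightarrow> nat \<Rightarrow> nat set" where
  "bump_rows D x = fst ` left_bumps D x"

lemma bump_rows_iff:
  assumes "pipe_dream D"
  shows "i \<in> bump_rows D x \<longleftrightarrow> 1 \<le> i \<and> (\<exists>j\<ge>1. (i, j) \<notin> D \<and> pipe_top D i j = x)"
  by (force simp: bump_rows_def left_bumps_def enters_top_iff[OF assms] image_iff)

lemma no_bump_row:
  assumes "pipe_dream D" "(i, j) \<in> D"
  shows "i \<notin> bump_rows D (pipe_top D i j)"
  using assms(2) pipe_top_eq_iff[OF assms(1), of i] by (auto simp: bump_rows_iff[OF assms(1)])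

text \<open>A pipe enters each row from the top at most once, so its left bumps lie in distinct rows
  and can be counted by them.\<close>

lemma bumps_below_eq:
  assumes "pipe_dream D"
  shows "bumps_below D x y = card {i \<in> bump_rows D x. fst (crossing D x y) < i}"
proof -
  let ?S = "{p \<in> left_bumps D x. fst (crossing D x y) < fst p}"
  have "inj_on fst ?S"
  proof (rule inj_onI)
    fix p q assume "p \<in> ?S" "q \<in> ?S" "fst p = fst q"
    then show "p = q"
      using pipe_top_eq_iff[OF assms, of "fst p" "snd p" "snd q"]
      by (auto simp: left_bumps_def enters_top_iff[OF assms] prod_eq_iff)
  qed
  moreover have "fst ` ?S = {i \<in> bump_rows D x. fst (crossing D x y) < i}"
    by (auto simp: bump_rows_def)
  ultimately show ?thesis
    unfolding bumps_below_def by (metis (lifting) card_image)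
qed

text \<open>
  In each row up to the one where it exits, a pipe either has a left bump or crosses vertically, and
  its vertical crossings correspond to inversions.
\<close>

lemma card_bump_rows:
  assumes w: "w permutes {1..n}" and D: "D \<in> RPD w" and x: "1 \<le> x"
  shows "finite (bump_rows D x)"
    and "card (bump_rows D x) + card {y. (x, y) \<in> inversions (inv w)} = inv w x"
proof -
  note pd = RPD_D(1)[OF D]
  define e where "e = inv w x"
  define V where "V = {p \<in> D. pipe_top D (fst p) (snd p) = x}"
  have e: "1 \<le> e" "pipe_top D (Suc e) 0 = x"
    using permutes_pos[OF permutes_inv[OF w] x] RPD_D(2)[OF D] permutes_inverses(1)[OF w]
    by (auto simp: e_def)
  \<comment> \<open>After the exit row the label survives only in column 0 of row
    \<open>Suc e\<close>; it never returns to a positive column.\<close>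
  have dead: "x \<notin> pipe_top D i ` {1..}" if "Suc e \<le> i" for i
    using that
  proof (induction i rule: dec_induct)
    case base
    have "pipe_top D (Suc e) j \<noteq> pipe_top D (Suc e) 0" if "1 \<le> j" for j
      using that pipe_top_eq_iff[OF pd, of "Suc e" j 0] by simp
    then show ?case using e(2) by (metis atLeast_iff imageE)
  next
    case (step i)
    then show ?case using pipe_top_Suc_image[OF pd, of i] by blast
  qed
  have alive: "x \<in> pipe_top D i ` {1..}" if "i \<le> e" for i
    using that
  proof (induction i rule: inc_induct)
    case base
    then show ?case using e(2) pipe_top_Suc_image[OF pd, of e] by blast
  next
    case (step i)
    then show ?case using pipe_top_Suc_image[OF pd, of i] by blast
  qed
  have V_iff: "i \<in> fst ` V \<longleftrightarrow> 1 \<le> i \<and> (\<exists>j\<ge>1. (i, j) \<in> D \<and> pipe_top D i j = x)" for i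
    using pd by (force simp: V_def image_iff pipe_dream_def)
  have union: "bump_rows D x \<union> fst ` V = {1..e}"
  proof (intro equalityI subsetI)
    fix i assume "i \<in> bump_rows D x \<union> fst ` V"
    then have "1 \<le> i" "x \<in> pipe_top D i ` {1..}"
      by (auto simp: bump_rows_iff[OF pd] V_iff)
    then show "i \<in> {1..e}" using dead[of i] by force
  next
    fix i assume "i \<in> {1..e}"
    then show "i \<in> bump_rows D x \<union> fst ` V"
      using alive[of i] by (auto simp: bump_rows_iff[OF pd] V_iff)
  qed
  then show fin: "finite (bump_rows D x)"
    by (metis finite_Un finite_atLeastAtMost)
  have disj: "bump_rows D x \<inter> fst ` V = {}"
  proof (rule equals0I)
    fix i assume "i \<in> bump_rows D x \<inter> fst ` V"
    then obtain j j' where "1 \<le> i" "(i, j) \<notin> D" "(i, j') \<in> D"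
        "pipe_top D i j = x" "pipe_top D i j' = x"
      by (auto simp: bump_rows_iff[OF pd] V_iff)
    then show False using pipe_top_eq_iff[OF pd, of i j j'] by auto
  qed
  have finV: "finite V"
    using pipe_dream_finite[OF pd] by (simp add: V_def)
  have "inj_on fst V"
  proof (rule inj_onI)
    fix p q assume pq: "p \<in> V" "q \<in> V" "fst p = fst q"
    have "p \<in> {1..} \<times> {1..}"
      using pq(1) pd unfolding V_def pipe_dream_def by blast
    then have "1 \<le> fst p" by auto
    moreover have "pipe_top D (fst p) (snd p) = pipe_top D (fst p) (snd q)"
      using pq unfolding V_def by simp
    ultimately have "snd p = snd q"
      using pipe_top_eq_iff[OF pd] by blast
    then show "p = q" using pq(3) by (rule prod_eqI[rotated])
  qed
  then have "card (fst ` V) = card V"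
    by (rule card_image)
  also have "\<dots> = card (Pair x ` {y. (x, y) \<in> inversions (inv w)})"
  proof (rule bij_betw_same_card)
    have "Pair x ` {y. (x, y) \<in> inversions (inv w)} = pipe_pair D ` V"
    proof (intro equalityI subsetI)
      fix p assume "p \<in> Pair x ` {y. (x, y) \<in> inversions (inv w)}"
      then obtain y where p: "p = (x, y)" "(x, y) \<in> inversions (inv w)" by auto
      obtain i j where "(i, j) \<in> D" "pipe_top D i j = x" "pipe_right D i j = y"
        using RPD_crossing_exists[OF w D p(2)] .
      then show "p \<in> pipe_pair D ` V"
        by (auto simp: p(1) V_def pipe_pair_def intro!: image_eqI[of _ _ "(i, j)"])
    next
      fix p assume "p \<in> pipe_pair D ` V"
      then obtain i j where "(i, j) \<in> D" "pipe_top D i j = x" "p = (x, pipe_right D i j)"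
        by (auto simp: V_def pipe_pair_def)
      then show "p \<in> Pair x ` {y. (x, y) \<in> inversions (inv w)}"
        using RPD_crossing(1)[OF w D, of i j] by auto
    qed
    then show "bij_betw (pipe_pair D) V (Pair x ` {y. (x, y) \<in> inversions (inv w)})"
      using bij_betw_imp_inj_on[OF RPD_bij_betw[OF w D]] inj_on_subset[of _ D V]
      by (auto simp: bij_betw_def V_def)
  qed
  also have "\<dots> = card {y. (x, y) \<in> inversions (inv w)}"
    by (intro card_image) (simp add: inj_on_def)
  finally show "card (bump_rows D x) + card {y. (x, y) \<in> inversions (inv w)} = inv w x"
    using card_Un_disjoint[OF fin finite_imageI[OF finV] disj] union by (simp add: e_def)
qed

section \<open>The effect of a ladder move\<close>

lemma next_bump_cong:
  assumes "\<And>d. j < d \<Longrightarrow> (i, d) \<in> D \<longleftrightarrow> (i, d) \<in> D'"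
  shows "next_bump D i j = next_bump D' i j"
  unfolding next_bump_def using assms by (metis (lifting))

text \<open>\<open>A\<close> is the pipe dream before the move and \<open>B\<close> the one after.
  Membership in \<open>RPD w\<close> is left out of the assumptions because it passes in both
  directions (\<open>RPD_iff\<close>), and the inverse move starts from knowledge about
  \<open>B\<close>.\<close>

locale ladder_rectangle =
  fixes A B :: "cell set" and h i j k :: nat
  assumes pd: "pipe_dream A"
    and bounds: "1 \<le> h" "h < i" "1 \<le> j" "j < k"
    and corners: "(i, j) \<in> A" "(h, j) \<notin> A" "(i, k) \<notin> A" "(h, k) \<notin> A"
    and full: "{h..i} \<times> {j..k} - {(i, j), (h, j), (i, k), (h, k)} \<subseteq> A"
    and B: "B = insert (h, k) (A - {(i, j)})"
begin

lemma pdB: "pipe_dream B"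
  using pd bounds by (auto simp: pipe_dream_def B)

lemma B_iff: "(r, c) \<in> B \<longleftrightarrow> (r, c) = (h, k) \<or> (r, c) \<in> A \<and> (r, c) \<noteq> (i, j)"
  by (auto simp: B)

lemma inside:
  assumes "h \<le> r" "r \<le> i" "j \<le> c" "c \<le> k" "h < r \<and> r < i \<or> j < c \<and> c < k"
  shows "(r, c) \<in> A" "(r, c) \<in> B"
proof -
  show "(r, c) \<in> A" using assms full by (auto simp: subset_iff)
  then show "(r, c) \<in> B" using assms by (auto simp: B_iff)
qed

lemma finA: "finite A" and finB: "finite B"
  using pd pdB by (auto simp: pipe_dream_def)

lemmas nextA = next_bump[OF finA]

lemma next_bump_outside:
  assumes "r \<notin> {h, i} \<or> k \<le> c"
  shows "next_bump B r c = next_bump A r c"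
  using assms bounds by (intro next_bump_cong) (auto simp: B_iff)

text \<open>The bump at \<open>(h, j)\<close> stops the search before it can reach the changed tile
  \<open>(h, k)\<close>.\<close>

lemma next_bump_h_left:
  assumes "c < j"
  shows "next_bump B h c = next_bump A h c" "next_bump A h c \<le> j"
proof -
  show *: "next_bump A h c \<le> j"
    using nextA(3)[of c j h] assms corners(2) by force
  show "next_bump B h c = next_bump A h c"
    using nextA(1,2)[where i = h and j = c] nextA(3)[where i = h and j = c] * bounds
    by (intro next_bump_eqI) (auto simp: B_iff)
qed

lemma next_bump_h_mid:
  assumes "j \<le> c" "c < k"
  shows "next_bump A h c = k" "next_bump B h c = next_bump A h k"
proof -
  show "next_bump A h c = k"
    using assms(2) corners(4)
  proof (rule next_bump_eqI)
    show "(h, d) \<in> A" if "c < d" "d < k" for d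
      using inside(1)[of h d] that assms bounds by simp
  qed
  have "next_bump B h c = next_bump B h k"
  proof (rule next_bump_skip)
    show "(h, d) \<in> B" if "c < d" "d \<le> k" for d
      using that assms bounds inside(2)[of h d] by (cases "d = k") (auto simp: B_iff)
  qed (use assms finB in auto)
  then show "next_bump B h c = next_bump A h k"
    using next_bump_outside[of h k] by simp
qed

text \<open>A search from the left in row \<open>i\<close> of \<open>A\<close> ends before column
  \<open>j\<close> or runs through to the bump \<open>(i, k)\<close>; in \<open>B\<close> the latter
  stops at the new bump \<open>(i, j)\<close>.\<close>

lemma next_bump_i_left:
  assumes "c < j"
  shows "next_bump B i c = transpose j k (next_bump A i c)"
proof -
  define d where "d = next_bump A i c"
  note d = nextA[where i = i and j = c, folded d_def]
  have "d \<le> k"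
    using d(3)[of k] assms bounds corners(3) by force
  moreover have "d \<noteq> j" using d(2) corners(1) by blast
  moreover have "\<not> (j < d \<and> d < k)" using d(2) inside(1)[of i d] bounds by auto
  ultimately consider "d < j" | "d = k" by linarith
  then show ?thesis
  proof cases
    case 1
    then have "next_bump B i c = d"
      using d bounds by (intro next_bump_eqI) (auto simp: B_iff)
    then show ?thesis using 1 bounds by (simp add: d_def[symmetric] transpose_apply_other)
  next
    case 2
    then have "next_bump B i c = j"
      using d assms bounds by (intro next_bump_eqI) (auto simp: B_iff)
    then show ?thesis using 2 by (simp add: d_def[symmetric])
  qed
qed

lemma next_bump_i_mid:
  assumes "j \<le> c" "c < k"
  shows "next_bump A i c = k" "next_bump B i c = k"
proof -
  have "(i, d) \<in> A \<and> (i, d) \<in> B" if "c < d" "d < k" for d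
    using inside[of i d] that assms bounds by simp
  moreover have "(i, k) \<notin> B" using corners bounds by (simp add: B_iff)
  ultimately show "next_bump A i c = k" "next_bump B i c = k"
    using assms(2) corners(3) next_bump_eqI by blast+
qed

text \<open>Both vertical sides of the rectangle are crosses in the inner rows, so neither
  \<open>j\<close> nor \<open>k\<close> is ever found.\<close>

lemma next_bump_avoids:
  assumes "h < r" "r < i"
  shows "transpose j k (next_bump A r c) = next_bump A r c"
  using inside(1)[of r j] inside(1)[of r k] nextA(2)[of r c] assms bounds
  by (intro transpose_apply_other) auto

text \<open>Row \<open>h\<close> creates an exchange of columns \<open>j\<close> and
  \<open>k\<close>, \<open>source_mid\<close> carries it through the inner rows, and
  \<open>source_i\<close> undoes it, so that the labels agree again from row \<open>i + 1\<close>
  on.\<close>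

lemma source_h: "source B h c = source A h (transpose j k c)"
proof -
  consider "c < j" | "c = j" | "j < c \<and> c < k" | "c = k" | "k < c" by linarith
  then show ?thesis
  proof cases
    case 1
    then show ?thesis
      using bounds next_bump_h_left by (auto simp: source_def transpose_apply_other B_iff)
  next
    case 2
    then show ?thesis
      using bounds corners next_bump_h_mid(2)[of j] by (auto simp: source_def B_iff)
  next
    case 3
    then show ?thesis
      using bounds inside[of h c] by (auto simp: source_def transpose_apply_other)
  next
    case 4
    then show ?thesis
      using bounds corners next_bump_h_mid(1)[of j] by (auto simp: source_def B_iff)
  next
    case 5
    then show ?thesis
      using bounds next_bump_outside[of h c] by (auto simp: source_def transpose_apply_other B_iff)
  qed
qed

lemma source_i: "transpose j k (source B i c) = source A i c"
proof -
  consider "c < j" | "c = j" | "j < c \<and> c < k" | "c = k" | "k < c" by linarith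
  then show ?thesis
  proof cases
    case 1
    then show ?thesis
      using bounds next_bump_i_left by (auto simp: source_def transpose_apply_other B_iff)
  next
    case 2
    then show ?thesis
      using bounds corners next_bump_i_mid(2)[of j] by (auto simp: source_def B_iff)
  next
    case 3
    then show ?thesis
      using bounds inside[of i c] by (auto simp: source_def transpose_apply_other)
  next
    case 4
    then show ?thesis
      using bounds corners next_bump_outside[of i k] nextA(1)[of k i]
      by (auto simp: source_def transpose_apply_other B_iff)
  next
    case 5
    then show ?thesis
      using bounds next_bump_outside[of i c] nextA(1)[of c i]
      by (auto simp: source_def transpose_apply_other B_iff)
  qed
qed

lemma source_mid:
  assumes "h < r" "r < i"
  shows "transpose j k (source B r c) = source A r (transpose j k c)"
proof (cases "c \<in> {j, k}")
  case True
  then show ?thesis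
    using inside[of r j] inside[of r k] assms bounds by (auto simp: source_def)
next
  case False
  then show ?thesis
    using next_bump_avoids[OF assms, of c] next_bump_outside[of r c] assms
    by (auto simp: source_def transpose_apply_other B_iff)
qed

lemma pipe_top_B:
  "pipe_top B r c = (if h < r \<and> r \<le> i then pipe_top A r (transpose j k c) else pipe_top A r c)"
proof (induction r arbitrary: c)
  case 0
  then show ?case by simp
next
  case (Suc r)
  consider "r < h \<or> i < r" | "r = h" | "h < r \<and> r < i" | "r = i" by linarith
  then show ?case
  proof cases
    case 1
    then have "source B r c = source A r c"
      using next_bump_outside[of r c] bounds by (auto simp: source_def B_iff)
    then show ?thesis using Suc[of "source B r c"] 1 by auto
  next
    case 2
    then show ?thesis using Suc[of "source B r c"] source_h bounds by auto
  next
    case 3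
    then show ?thesis using Suc[of "source B r c"] source_mid[of r c] by auto
  next
    case 4
    then show ?thesis using Suc[of "source B r c"] source_i[of c] bounds by auto
  qed
qed

text \<open>In \<open>A\<close> this pipe turns left at \<open>(h, k)\<close>, runs along row
  \<open>h\<close> and goes down column \<open>j\<close>; in \<open>B\<close> it goes down column
  \<open>k\<close>, turns left at \<open>(i, k)\<close> and runs along row \<open>i\<close>. Its
  left bump thus moves from row \<open>h\<close> to row \<open>i\<close>.\<close>

abbreviation "P \<equiv> pipe_top A h k"

lemma pipe_top_A_j: "h < r \<Longrightarrow> r \<le> i \<Longrightarrow> pipe_top A r j = P"
  and pipe_top_A_k: "h < r \<Longrightarrow> r \<le> i \<Longrightarrow> pipe_top A r k = pipe_right A h k"
proof -
  assume r: "h < r" "r \<le> i"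
  have "pipe_top A r j = pipe_top A (Suc h) j"
    using r inside(1) bounds by (intro pipe_top_column) auto
  also have "\<dots> = P"
    using pipe_top_Suc_bump[OF corners(2)] next_bump_h_mid(1)[of j] bounds
    by (simp add: pipe_right_def)
  finally show "pipe_top A r j = P" .
  have "pipe_top A r k = pipe_top A (Suc h) k"
    using r inside(1) bounds by (intro pipe_top_column) auto
  also have "\<dots> = pipe_right A h k"
    using pipe_top_Suc_bump[OF corners(4)] by simp
  finally show "pipe_top A r k = pipe_right A h k" .
qed

lemma pipe_top_A_mid:
  assumes "j < c" "c < k" "h \<le> r" "r \<le> i"
  shows "pipe_top A r c = pipe_top A h c"
  using assms inside(1) by (intro pipe_top_column) auto

text \<open>The exits are read off in column 0, which the exchange of the positive columns
  \<open>j\<close> and \<open>k\<close> leaves fixed.\<close>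

lemma RPD_iff: "A \<in> RPD w \<longleftrightarrow> B \<in> RPD w"
proof -
  have "pipe_top B (Suc r) 0 = pipe_top A (Suc r) 0" for r
    using pipe_top_B[of "Suc r" 0] bounds by (auto simp: transpose_apply_other)
  then have "has_permutation B w \<longleftrightarrow> has_permutation A w"
    using has_permutation_iff[OF pd] has_permutation_iff[OF pdB] by simp
  moreover have "card B = card A"
    using finA corners card_Suc_Diff1[OF finA corners(1)] by (simp add: B)
  ultimately show ?thesis
    using pd pdB by (simp add: RPD_def)
qed

text \<open>Sends a cross of \<open>A\<close> to the cross of \<open>B\<close> where the same two
  pipes meet: \<open>(i, j)\<close> goes to \<open>(h, k)\<close>, and the interiors of opposite
  sides of the rectangle are exchanged.\<close>

definition moved :: "cell \<Rightarrow> cell" where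
  "moved = (\<lambda>(r, c).
     if (r, c) = (i, j) then (h, k)
     else if h < r \<and> r < i \<and> c \<in> {j, k} then (r, transpose j k c)
     else if r = h \<and> j < c \<and> c < k then (i, c)
     else if r = i \<and> j < c \<and> c < k then (h, c)
     else (r, c))"

lemma moved_crossing:
  assumes "(r, c) \<in> A" "moved (r, c) = (r', c')"
  shows "(r', c') \<in> B \<and> pipe_top B r' c' = pipe_top A r c \<and> pipe_right B r' c' = pipe_right A r c"
proof -
  consider "(r, c) = (i, j)" | "h < r \<and> r < i \<and> c \<in> {j, k}" | "r = h \<and> j < c \<and> c < k"
    | "r = i \<and> j < c \<and> c < k" | "(r, c) \<noteq> (i, j)"
      "\<not> (h < r \<and> r < i \<and> c \<in> {j, k})" "\<not> (r = h \<and> j < c \<and> c < k)" "\<not> (r = i \<and> j < c \<and> c < k)"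
    by blast
  then show ?thesis
  proof cases
    case 1
    then have "r' = h" "c' = k" using assms by (auto simp: moved_def)
    then show ?thesis
      using 1 bounds pipe_top_B[of h] pipe_top_A_j[of i] pipe_top_A_k[of i]
        next_bump_outside[of h k] next_bump_i_mid(1)[of j]
      by (auto simp: B_iff pipe_right_def)
  next
    case 2
    then have eqs: "r' = r" "c' = transpose j k c" using assms bounds by (auto simp: moved_def)
    have "next_bump A r j = next_bump A r k"
      using 2 inside(1) bounds finA by (intro next_bump_skip) auto
    then have "next_bump A r c' = next_bump A r c" using 2 eqs by auto
    then show ?thesis
      using 2 eqs bounds pipe_top_B[of r] inside(2)[of r c'] next_bump_outside[of r c']
        next_bump_avoids[of r c]
      by (auto simp: pipe_right_def)
  next
    case 3
    then have "r' = i" "c' = c" using assms bounds by (auto simp: moved_def)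
    then show ?thesis
      using 3 bounds inside(2)[of i c] pipe_top_B[of i] pipe_top_A_mid[of c i]
        next_bump_h_mid(1)[of c] next_bump_i_mid(2)[of c] pipe_top_A_j[of i]
      by (auto simp: pipe_right_def transpose_apply_other)
  next
    case 4
    then have "r' = h" "c' = c" using assms bounds by (auto simp: moved_def)
    then show ?thesis
      using 4 bounds inside(2)[of h c] pipe_top_B[of h] pipe_top_A_mid[of c i]
        next_bump_h_mid(2)[of c] next_bump_i_mid(1)[of c] pipe_top_A_k[of i]
      by (auto simp: pipe_right_def)
  next
    case 5
    then have "moved (r, c) = (r, c)" by (simp only: moved_def prod.case if_False)
    then have eqs: "r' = r" "c' = c" using assms(2) by auto
    have c: "c \<notin> {j, k} \<or> \<not> (h < r \<and> r \<le> i)"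
      using 5 assms(1) corners by (cases "r = i") auto
    then have top: "pipe_top B r c = pipe_top A r c"
      using pipe_top_B[of r c] by (auto simp: transpose_apply_other)
    have "(r, c) \<in> B" using 5 assms(1) by (auto simp: B_iff)
    moreover have "pipe_right B r c = pipe_right A r c"
    proof -
      \<comment> \<open>In rows \<open>h\<close> and \<open>i\<close> a remaining cross lies left of
        column \<open>j\<close> or in a column from \<open>k\<close> on, where the next bumps of
        \<open>A\<close> and \<open>B\<close> have been compared.\<close>
      have "r = h \<Longrightarrow> c \<noteq> j" "r = i \<Longrightarrow> c \<noteq> j"
        using 5(1) assms(1) corners(2) by auto
      then have "r = h \<Longrightarrow> c < j \<or> k \<le> c" "r = i \<Longrightarrow> c < j \<or> k \<le> c"
        using 5(3,4) by (metis linorder_neqE_nat not_le)+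
      moreover have "r < h \<or> i < r \<or> r = h \<or> r = i \<or> h < r \<and> r < i"
        by linarith
      ultimately consider "r < h \<or> i < r" | "r = h" "c < j" | "r = h" "k \<le> c" | "h < r" "r < i"
        | "r = i" "c < j" | "r = i" "k \<le> c"
        by blast
      then show ?thesis
      proof cases
        case 1
        then show ?thesis
          using pipe_top_B[of r] next_bump_outside[of r c] bounds by (auto simp: pipe_right_def)
      next
        case 2
        then show ?thesis
          using pipe_top_B[of r] next_bump_h_left[of c] by (auto simp: pipe_right_def)
      next
        case 3
        then show ?thesis
          using pipe_top_B[of r] next_bump_outside[of r c] by (auto simp: pipe_right_def)
      next
        case 4
        then show ?thesis
          using pipe_top_B[of r] next_bump_outside[of r c] next_bump_avoids[of r c]
          by (auto simp: pipe_right_def)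
      next
        case 5
        then show ?thesis
          using pipe_top_B[of r] next_bump_i_left[of c] bounds by (auto simp: pipe_right_def)
      next
        case 6
        then show ?thesis
          using pipe_top_B[of r] next_bump_outside[of r c] nextA(1)[of c r] bounds
          by (auto simp: pipe_right_def transpose_apply_other)
      qed
    qed
    ultimately show ?thesis using eqs top by simp
  qed
qed

section \<open>Left bumps and tableau entries after a move\<close>

lemma bump_rows_A_P:
  shows "h \<in> bump_rows A P" and "h < r \<Longrightarrow> r \<le> i \<Longrightarrow> r \<notin> bump_rows A P"
proof -
  show "h \<in> bump_rows A P"
    using bounds corners by (auto simp: bump_rows_iff[OF pd] intro!: exI[of _ k])
  assume r: "h < r" "r \<le> i"
  then have "(r, j) \<in> A"
    using inside(1)[of r j] corners bounds by (cases "r = i") auto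
  then show "r \<notin> bump_rows A P"
    using no_bump_row[OF pd, of r j] pipe_top_A_j[OF r] r bounds by simp
qed

lemma bump_rows_B:
  "r \<in> bump_rows B x \<longleftrightarrow> (if x = P \<and> r \<in> {h, i} then r = i else r \<in> bump_rows A x)"
proof -
  consider "r < h \<or> i < r" | "r = h" | "h < r \<and> r < i" | "r = i" by linarith
  then show ?thesis
  proof cases
    case 1
    then have "(r, c) \<in> B \<longleftrightarrow> (r, c) \<in> A" for c using bounds by (auto simp: B_iff)
    then show ?thesis
      using 1 pipe_top_B[of r] bounds by (auto simp: bump_rows_iff[OF pd] bump_rows_iff[OF pdB])
  next
    case 2
    have "(r, c) \<in> B \<longleftrightarrow> (r, c) \<in> A \<or> c = k" for c using 2 bounds by (auto simp: B_iff)
    then show ?thesis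
      using 2 pipe_top_B[of r] bounds pipe_top_eq_iff[OF pd, of h _ k]
      by (auto simp: bump_rows_iff[OF pd] bump_rows_iff[OF pdB])
  next
    case 3
    then have "(r, c) \<in> B \<longleftrightarrow> (r, c) \<in> A" for c by (auto simp: B_iff)
    moreover have "(r, j) \<in> A" "(r, k) \<in> A" using 3 inside(1) bounds by auto
    moreover have "pipe_top B r c = pipe_top A r c" if "(r, c) \<notin> A" for c
    proof -
      have "c \<noteq> j" "c \<noteq> k" using that calculation(2,3) by auto
      then show ?thesis using pipe_top_B[of r c] by (simp add: transpose_apply_other)
    qed
    ultimately show ?thesis
      using 3 by (auto simp: bump_rows_iff[OF pd] bump_rows_iff[OF pdB])
  next
    case 4
    have top: "pipe_top B i c = pipe_top A i (transpose j k c)" for c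
      using pipe_top_B[of i c] bounds by simp
    have "(i, c) \<in> B \<longleftrightarrow> (i, transpose j k c) \<in> A \<and> c \<noteq> k" if "c \<noteq> k" for c
      using that bounds corners by (cases "c = j") (auto simp: B_iff transpose_apply_other)
    moreover have "(i, k) \<notin> B" using bounds corners by (auto simp: B_iff)
    ultimately have bump: "(i, c) \<notin> B \<longleftrightarrow> c = k \<or> (i, transpose j k c) \<notin> A" for c
      by (cases "c = k") auto
    \<comment> \<open>Reindexed by the transposition, the bumps in row \<open>i\<close> of
      \<open>B\<close> are those of \<open>A\<close> together with column \<open>j\<close>, which
      carries \<open>P\<close>.\<close>
    have "i \<in> bump_rows B x \<longleftrightarrow> (\<exists>c\<ge>1. (c = k \<or> (i, transpose j k c) \<notin> A) \<and>
        pipe_top A i (transpose j k c) = x)"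
      using bounds by (simp add: bump_rows_iff[OF pdB] top bump)
    also have "\<dots> \<longleftrightarrow> (\<exists>c\<ge>1. (c = j \<or> (i, c) \<notin> A) \<and> pipe_top A i c = x)"
    proof -
      have "1 \<le> transpose j k c \<longleftrightarrow> 1 \<le> c" for c
        using bounds by (auto simp: transpose_def)
      moreover have "c = k \<longleftrightarrow> transpose j k c = j" for c
        using bounds by (auto simp: transpose_def)
      ultimately show ?thesis
        by (metis transpose_involutory)
    qed
    also have "\<dots> \<longleftrightarrow> x = P \<or> i \<in> bump_rows A x"
      using bounds pipe_top_A_j[of i] by (auto simp: bump_rows_iff[OF pd])
    finally show ?thesis using 4 bounds by auto
  qed
qed

text \<open>For \<open>x\<close> other than \<open>P\<close> the bump rows stay the same, and the
  crossing changes row only in a column strictly inside the rectangle, down which \<open>x\<close>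
  runs without bumps. For \<open>P\<close>, a crossing above row \<open>h\<close> trades the bump in
  row \<open>h\<close> for one in row \<open>i\<close>, below row \<open>i\<close> nothing changes,
  and otherwise the bump in row \<open>i\<close> is gained.\<close>

lemma bumps_below_B:
  assumes w: "w permutes {1..n}" and RPD: "A \<in> RPD w" and xy: "(x, y) \<in> inversions (inv w)"
  shows "bumps_below B x y = bumps_below A x y \<or>
    bumps_below B x y = Suc (bumps_below A x y) \<and> x = P \<and>
    h \<le> fst (crossing B x y) \<and> fst (crossing B x y) < i"
proof -
  obtain r c where rc: "(r, c) \<in> A" "pipe_top A r c = x" "pipe_right A r c = y"
      "crossing A x y = (r, c)"
    using RPD_crossing_exists[OF w RPD xy] by blast
  obtain r' c' where m: "moved (r, c) = (r', c')" by force
  have rB: "crossing B x y = (r', c')"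
    using moved_crossing[OF rc(1) m] rc RPD_crossing(2)[OF w, of B r' c'] RPD RPD_iff[of w] by auto
  have r1: "1 \<le> r" using pd rc(1) by (auto simp: pipe_dream_def)
  have fin: "finite (bump_rows A x)"
    using card_bump_rows(1)[OF w RPD, of x] xy by (auto simp: inversions_def)
  have below: "bumps_below A x y = card {t \<in> bump_rows A x. r < t}"
    "bumps_below B x y = card {t \<in> bump_rows B x. r' < t}"
    using bumps_below_eq[OF pd] bumps_below_eq[OF pdB] rc rB by auto
  show ?thesis
  proof (cases "x = P")
    case False
    then have eq: "bump_rows B x = bump_rows A x" using bump_rows_B[of _ x] by auto
    have c_ne: "r \<noteq> i \<or> c \<noteq> j"
      using False rc pipe_top_A_j[of i] bounds by auto
    have "{t \<in> bump_rows A x. r < t} = {t \<in> bump_rows A x. r' < t}"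
    proof (cases "r' = r")
      case False
      then have cases: "r \<in> {h, i}" "r' \<in> {h, i}" "j < c" "c < k"
        using m c_ne by (auto simp: moved_def split: if_splits)
      have "t \<notin> bump_rows A x" if "h \<le> t" "t \<le> i" for t
      proof -
        have "pipe_top A t c = x"
          using pipe_top_A_mid[of c t] pipe_top_A_mid[of c r] that cases rc(2) bounds by auto
        then show ?thesis
          using no_bump_row[OF pd, of t c] inside(1)[of t c] that cases bounds by auto
      qed
      then show ?thesis using cases(1,2) bounds by (auto simp: not_le[symmetric])
    qed simp
    then show ?thesis using below eq by simp
  next
    case True
    \<comment> \<open>Row \<open>h\<close> does not occur, since \<open>P\<close> has a left bump
      there; in the rows after it, down to \<open>i\<close>, \<open>P\<close> passes vertically in
      column \<open>j\<close>.\<close>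
    consider "r < h" | "i < r" | "h < r" "r \<le> i" "c = j"
    proof -
      have "c = j" if "h < r" "r \<le> i"
        using pipe_top_A_j[OF that] rc(2) True pipe_top_eq_iff[OF pd r1, of c j] by auto
      moreover have "r \<noteq> h"
        using rc(1,2) True pipe_top_eq_iff[OF pd r1, of c k] corners by auto
      ultimately show ?thesis using that by linarith
    qed
    then show ?thesis
    proof cases
      case 1
      then have "r' = r" using m bounds by (auto simp: moved_def split: if_splits)
      then have "{t \<in> bump_rows B x. r' < t} = insert i ({t \<in> bump_rows A x. r < t} - {h})"
        using 1 True bounds bump_rows_B[of _ P] by auto
      moreover have "i \<notin> {t \<in> bump_rows A x. r < t} - {h}" "h \<in> {t \<in> bump_rows A x. r < t}"
        using bump_rows_A_P True bounds 1 by auto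
      ultimately show ?thesis
        using below fin card_Suc_Diff1[of "{t \<in> bump_rows A x. r < t}" h] by simp
    next
      case 2
      then have "r' = r" using m bounds by (auto simp: moved_def split: if_splits)
      then have "{t \<in> bump_rows B x. r' < t} = {t \<in> bump_rows A x. r < t}"
        using 2 True bounds bump_rows_B[of _ P] by auto
      then show ?thesis using below by simp
    next
      case 3
      then have r': "h \<le> r'" "r' < i" "r' = (if r = i then h else r)"
        using m bounds by (auto simp: moved_def split: if_splits)
      have A_P: "t \<in> bump_rows A P \<Longrightarrow> h < t \<Longrightarrow> i < t" for t
        using bump_rows_A_P(2)[of t] by force
      then have "{t \<in> bump_rows B x. r' < t} = insert i {t \<in> bump_rows A x. r < t}"
        using 3 r' True bounds bump_rows_B[of _ P] by (auto split: if_splits)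
      moreover have "i \<notin> {t \<in> bump_rows A x. r < t}"
        using bump_rows_A_P(2)[of i] True bounds by auto
      ultimately show ?thesis
        using below fin r' rB True by simp
    qed
  qed
qed

end

section \<open>Monotonicity of the tableau under ladder moves\<close>

lemma ladder_moveE:
  assumes "ladder_move w A B"
  obtains h i j k where "A \<in> RPD w" "ladder_rectangle A B h i j k"
proof -
  from assms obtain h i j k where *: "A \<in> RPD w" "1 \<le> h" "h < i" "1 \<le> j" "j < k"
      "(i, j) \<in> A" "(h, j) \<notin> A" "(i, k) \<notin> A" "(h, k) \<notin> A"
      "{h..i} \<times> {j..k} - {(i, j), (h, j), (i, k), (h, k)} \<subseteq> A"
      "B = insert (h, k) (A - {(i, j)})"
    unfolding ladder_move_def by blast
  then have "ladder_rectangle A B h i j k"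
    using RPD_D(1)[OF *(1)] by unfold_locales
  then show ?thesis using that *(1) by blast
qed

lemma ladder_le_imp_bumps_below_le:
  assumes w: "w permutes {1..n}" and "ladder_le w D\<^sub>1 D\<^sub>2" and "D\<^sub>1 \<in> RPD w"
    and "(x, y) \<in> inversions (inv w)"
  shows "bumps_below D\<^sub>1 x y \<le> bumps_below D\<^sub>2 x y"
  using assms(2) unfolding ladder_le_def
proof (induction rule: rtranclp_induct)
  case (step A B)
  obtain h i j k where A: "A \<in> RPD w" and rect: "ladder_rectangle A B h i j k"
    using ladder_moveE[OF step.hyps(2)] .
  then show ?case
    using ladder_rectangle.bumps_below_B[OF rect w A assms(4)] step.IH by linarith
qed simp

lemma tableau_le_iff:
  assumes "w permutes {1..n}"
  shows "tableau_le w (pd_tableau w D\<^sub>1) (pd_tableau w D\<^sub>2) \<longleftrightarrow>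
    (\<forall>(x, y)\<in>inversions (inv w). bumps_below D\<^sub>1 x y \<le> bumps_below D\<^sub>2 x y)"
proof -
  have "pd_tableau w D (inv w (snd p), fst p) = bumps_below D (fst p) (snd p)"
    if "p \<in> inversions (inv w)" for p D
    using pd_tableau_entry[OF assms, of "fst p" "snd p"] that by simp
  then show ?thesis
    unfolding tableau_le_def case_prod_unfold by simp
qed

section \<open>Inverse ladder moves between comparable tableaux\<close>

text \<open>For crossings in row \<open>r\<close> or further down, the number of left bumps from row
  \<open>r\<close> on bounds the entry. Together with \<open>bumps_below_eq_from\<close>, the bound
  is attained exactly when no bump lies between row \<open>r\<close> and the crossing row, both
  included.\<close>

lemma bumps_below_less:
  assumes "pipe_dream D" "finite (bump_rows D x)"
    and "r \<le> t" "t \<le> fst (crossing D x y)" "t \<in> bump_rows D x"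
  shows "bumps_below D x y < card {s \<in> bump_rows D x. r \<le> s}"
proof -
  let ?S = "{s \<in> bump_rows D x. fst (crossing D x y) < s}"
  let ?T = "{s \<in> bump_rows D x. r \<le> s}"
  have "t \<in> ?T" "t \<notin> ?S" using assms(3-5) by simp_all
  moreover have "?S \<subseteq> ?T" using assms(3,4) by (intro Collect_mono) simp
  ultimately have "?S \<subset> ?T" by blast
  then have "card ?S < card ?T"
    using assms(2) by (intro psubset_card_mono) simp_all
  then show ?thesis by (simp only: bumps_below_eq[OF assms(1)])
qed

lemma bumps_below_eq_from:
  assumes "pipe_dream D" "r \<le> fst (crossing D x y)"
    and "\<And>t. r \<le> t \<Longrightarrow> t \<le> fst (crossing D x y) \<Longrightarrow> t \<notin> bump_rows D x"
  shows "bumps_below D x y = card {s \<in> bump_rows D x. r \<le> s}"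
proof -
  have "{i \<in> bump_rows D x. fst (crossing D x y) < i} = {s \<in> bump_rows D x. r \<le> s}"
  proof (intro Collect_cong conj_cong refl iffI)
    fix t assume t: "t \<in> bump_rows D x"
    show "r \<le> t" if "fst (crossing D x y) < t" using that assms(2) by simp
    show "fst (crossing D x y) < t" if "r \<le> t"
      using assms(3)[OF that] t by (cases "t \<le> fst (crossing D x y)") simp_all
  qed
  then show ?thesis by (simp only: bumps_below_eq[OF assms(1)])
qed

text \<open>
  In the first row \<open>r\<close> where the two pipe dreams differ, let \<open>(r, k)\<close> be the leftmost cross of
  \<open>D\<^sub>2\<close> missing from \<open>D\<^sub>1\<close>, and \<open>x\<close> the pipe entering there from the top.  In \<open>D\<^sub>2\<close> this pipe has
  no left bump in the rows \<open>r..<i\<close>, whereas in \<open>D\<^sub>1\<close> it has one in row \<open>r\<close>.  So all entries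
  \<open>(x, y)\<close> for crossings of \<open>D\<^sub>2\<close> in these rows exceed those of \<open>D\<^sub>1\<close>, and any inverse ladder move
  from one of these crossings, which lowers only such entries and these by 1, is harmless.
\<close>

lemma inverse_ladder_move_exists:
  assumes w: "w permutes {1..n}" and D1: "D\<^sub>1 \<in> RPD w" and D2: "D\<^sub>2 \<in> RPD w" and "D\<^sub>1 \<noteq> D\<^sub>2"
    and le: "\<And>x y. (x, y) \<in> inversions (inv w) \<Longrightarrow> bumps_below D\<^sub>1 x y \<le> bumps_below D\<^sub>2 x y"
  shows "\<exists>A. ladder_move w A D\<^sub>2 \<and> sum snd A < sum snd D\<^sub>2 \<and>
    (\<forall>(x, y)\<in>inversions (inv w). bumps_below D\<^sub>1 x y \<le> bumps_below A x y)"
proof -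
  note pd1 = RPD_D(1)[OF D1] and pd2 = RPD_D(1)[OF D2]
  note fin1 = pipe_dream_finite[OF pd1] and fin2 = pipe_dream_finite[OF pd2]
  define differ where "differ = (\<lambda>r. \<exists>c. ((r, c) \<in> D\<^sub>1) \<noteq> ((r, c) \<in> D\<^sub>2))"
  define r where "r = (LEAST r. differ r)"
  have "\<exists>r. differ r" using \<open>D\<^sub>1 \<noteq> D\<^sub>2\<close> by (auto simp: differ_def)
  then have r: "differ r" unfolding r_def by (rule LeastI_ex)
  have agree: "(s, c) \<in> D\<^sub>1 \<longleftrightarrow> (s, c) \<in> D\<^sub>2" if "s < r" for s c
    using not_less_Least[OF that[unfolded r_def]] by (auto simp: differ_def)
  have r1: "1 \<le> r"
    using r pipe_dream_no_zero[OF pd1] pipe_dream_no_zero[OF pd2]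
    by (cases r) (auto simp: differ_def)
  have next_bump_agree: "next_bump D\<^sub>1 s c = next_bump D\<^sub>2 s c" if "s < r" for s c
    using agree[OF that] by (intro next_bump_cong) auto
  have top_agree: "pipe_top D\<^sub>1 s c = pipe_top D\<^sub>2 s c" if "s \<le> r" for s c
    using that
  proof (induction s arbitrary: c)
    case (Suc s)
    then have "source D\<^sub>1 s c = source D\<^sub>2 s c"
      using agree[of s c] next_bump_agree[of s c] by (simp add: source_def)
    then show ?case using Suc by simp
  qed simp
  \<comment> \<open>The total number of left bumps depends on \<open>w\<close> alone
    (\<open>card_bump_rows\<close>), and the rows above \<open>r\<close> agree.\<close>
  have card_from: "card {s \<in> bump_rows D\<^sub>1 x. r \<le> s} = card {s \<in> bump_rows D\<^sub>2 x. r \<le> s}"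
    if x: "1 \<le> x" for x
  proof -
    have split: "card (bump_rows D x) =
        card {s \<in> bump_rows D x. s < r} + card {s \<in> bump_rows D x. r \<le> s}"
      if "finite (bump_rows D x)" for D
    proof -
      have "bump_rows D x = {s \<in> bump_rows D x. s < r} \<union> {s \<in> bump_rows D x. r \<le> s}"
        by auto
      moreover have "{s \<in> bump_rows D x. s < r} \<inter> {s \<in> bump_rows D x. r \<le> s} = {}"
        by auto
      ultimately show ?thesis
        using that card_Un_disjoint by (metis (lifting) finite_Un)
    qed
    have "{s \<in> bump_rows D\<^sub>1 x. s < r} = {s \<in> bump_rows D\<^sub>2 x. s < r}"
      using agree top_agree by (auto simp: bump_rows_iff[OF pd1] bump_rows_iff[OF pd2])
    then show ?thesis
      using split card_bump_rows[OF w D1 x] card_bump_rows[OF w D2 x] by fastforce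
  qed
  \<comment> \<open>A crossing above row \<open>r\<close> in one of the pipe dreams is the same
    cross in the other.\<close>
  have crossing_agree: "r \<le> fst (crossing D\<^sub>1 x y) \<longleftrightarrow> r \<le> fst (crossing D\<^sub>2 x y)"
    if xy: "(x, y) \<in> inversions (inv w)" for x y
  proof -
    obtain s c where 1: "(s, c) \<in> D\<^sub>1" "pipe_top D\<^sub>1 s c = x" "pipe_right D\<^sub>1 s c = y"
        "crossing D\<^sub>1 x y = (s, c)"
      using RPD_crossing_exists[OF w D1 xy] .
    obtain s' c' where 2: "(s', c') \<in> D\<^sub>2" "pipe_top D\<^sub>2 s' c' = x" "pipe_right D\<^sub>2 s' c' = y"
        "crossing D\<^sub>2 x y = (s', c')"
      using RPD_crossing_exists[OF w D2 xy] .
    have "crossing D\<^sub>2 x y = (s, c)" if "s < r"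
      using that 1 agree[of s c] top_agree[of s] next_bump_agree[of s c] RPD_crossing(2)[OF w D2, of s c]
      by (simp add: pipe_right_def)
    moreover have "crossing D\<^sub>1 x y = (s', c')" if "s' < r"
      using that 2 agree[of s' c'] top_agree[of s'] next_bump_agree[of s' c']
        RPD_crossing(2)[OF w D1, of s' c']
      by (simp add: pipe_right_def)
    ultimately show ?thesis using 1(4) 2(4) by (metis fst_conv not_le)
  qed
  have lt1: "bumps_below D\<^sub>1 x y < card {s \<in> bump_rows D\<^sub>1 x. r \<le> s}"
    if "(x, y) \<in> inversions (inv w)" "r \<le> t" "t \<le> fst (crossing D\<^sub>1 x y)" "t \<in> bump_rows D\<^sub>1 x" for x y t
    using bumps_below_less[OF pd1 card_bump_rows(1)[OF w D1], of x r t y] that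
    by (auto simp: inversions_def)
  have lt2: "bumps_below D\<^sub>2 x y < card {s \<in> bump_rows D\<^sub>2 x. r \<le> s}"
    if "(x, y) \<in> inversions (inv w)" "r \<le> t" "t \<le> fst (crossing D\<^sub>2 x y)" "t \<in> bump_rows D\<^sub>2 x" for x y t
    using bumps_below_less[OF pd2 card_bump_rows(1)[OF w D2], of x r t y] that
    by (auto simp: inversions_def)
  have row_max: "bumps_below D\<^sub>1 (pipe_top D\<^sub>1 r c) (pipe_right D\<^sub>1 r c) =
      card {s \<in> bump_rows D\<^sub>2 (pipe_top D\<^sub>1 r c). r \<le> s}" if c: "(r, c) \<in> D\<^sub>1" for c
  proof -
    let ?x = "pipe_top D\<^sub>1 r c"
    have "crossing D\<^sub>1 ?x (pipe_right D\<^sub>1 r c) = (r, c)" "1 \<le> ?x"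
      using RPD_crossing[OF w D1 c] by (auto simp: inversions_def)
    moreover from this have "bumps_below D\<^sub>1 ?x (pipe_right D\<^sub>1 r c) = card {s \<in> bump_rows D\<^sub>1 ?x. r \<le> s}"
      using no_bump_row[OF pd1 c] by (intro bumps_below_eq_from[OF pd1]) (auto dest: le_antisym)
    ultimately show ?thesis using card_from[of ?x] by simp
  qed
  \<comment> \<open>By \<open>row_max\<close> the entry in \<open>D\<^sub>1\<close> is the largest
    possible; a bump of \<open>D\<^sub>2\<close> at \<open>(r, c)\<close> would keep the entry of
    \<open>D\<^sub>2\<close> below that value.\<close>
  have row_mono: "(r, c) \<in> D\<^sub>2" if c: "(r, c) \<in> D\<^sub>1" for c
  proof (rule ccontr)
    assume "(r, c) \<notin> D\<^sub>2"
    define x y where "x = pipe_top D\<^sub>1 r c" and "y = pipe_right D\<^sub>1 r c"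
    have xy: "(x, y) \<in> inversions (inv w)" "crossing D\<^sub>1 x y = (r, c)"
      using RPD_crossing[OF w D1 c] by (auto simp: x_def y_def)
    have "1 \<le> c" using pd1 c by (auto simp: pipe_dream_def)
    then have "r \<in> bump_rows D\<^sub>2 x"
      using r1 \<open>(r, c) \<notin> D\<^sub>2\<close> top_agree[of r c] by (auto simp: bump_rows_iff[OF pd2] x_def)
    then have "bumps_below D\<^sub>2 x y < bumps_below D\<^sub>1 x y"
      using lt2[OF xy(1), of r] crossing_agree[OF xy(1)] xy(2) row_max[OF c] by (simp add: x_def y_def)
    then show False using le[OF xy(1)] by simp
  qed
  define k where "k = (LEAST c. (r, c) \<in> D\<^sub>2 \<and> (r, c) \<notin> D\<^sub>1)"
  have "\<exists>c. (r, c) \<in> D\<^sub>2 \<and> (r, c) \<notin> D\<^sub>1"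
    using r row_mono by (auto simp: differ_def)
  then have k: "(r, k) \<in> D\<^sub>2" "(r, k) \<notin> D\<^sub>1"
    unfolding k_def by (metis (mono_tags, lifting) LeastI)+
  have k_least: "(r, c) \<in> D\<^sub>1" if "(r, c) \<in> D\<^sub>2" "c < k" for c
    using not_less_Least[OF that(2)[unfolded k_def]] that(1) by blast
  have "1 \<le> k" using pd2 k(1) by (auto simp: pipe_dream_def)
  define x where "x = pipe_top D\<^sub>2 r k"
  have x1: "pipe_top D\<^sub>1 r k = x" using top_agree[of r k] by (simp add: x_def)
  \<comment> \<open>The rectangle has its right side in column \<open>k\<close>, down which pipe
    \<open>x\<close> falls from row \<open>r\<close> to the first bump, in row \<open>i\<close>.
    Then \<open>j\<close> is the nearest column to the left that is not full of crosses in these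
    rows (column 0 at worst), and \<open>h\<close> is the row of its lowest bump above row
    \<open>i\<close>.\<close>
  define i where "i = (LEAST s. r < s \<and> (s, k) \<notin> D\<^sub>2)"
  have "\<exists>s. r < s \<and> (s, k) \<notin> D\<^sub>2"
  proof -
    have "finite ({..r} \<union> fst ` D\<^sub>2)" using fin2 by simp
    then obtain s where "s \<notin> {..r} \<union> fst ` D\<^sub>2"
      using ex_new_if_finite infinite_UNIV_nat by blast
    then show ?thesis by (intro exI[of _ s]) force
  qed
  then have i: "r < i" "(i, k) \<notin> D\<^sub>2"
    unfolding i_def by (metis (mono_tags, lifting) LeastI)+
  have col_k: "(s, k) \<in> D\<^sub>2" if "r \<le> s" "s < i" for s
    using not_less_Least[OF that(2)[unfolded i_def]] that(1) k(1) by (cases "s = r") auto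
  have top_k: "pipe_top D\<^sub>2 s k = x" if "r \<le> s" "s \<le> i" for s
    unfolding x_def using that col_k by (intro pipe_top_column) auto
  define J where "J = {c. c < k \<and> (\<exists>s. r \<le> s \<and> s \<le> i \<and> (s, c) \<notin> D\<^sub>2)}"
  define j where "j = Max J"
  have "0 \<in> J" using \<open>1 \<le> k\<close> i pipe_dream_no_zero[OF pd2] by (auto simp: J_def)
  moreover have finJ: "finite J" by (simp add: J_def)
  ultimately have "j \<in> J" unfolding j_def by (intro Max_in) auto
  then have j: "j < k" "\<exists>s. r \<le> s \<and> s \<le> i \<and> (s, j) \<notin> D\<^sub>2" by (auto simp: J_def)
  have mid: "(s, c) \<in> D\<^sub>2" if "j < c" "c < k" "r \<le> s" "s \<le> i" for s c
  proof -
    have "c \<notin> J" using Max_ge[OF finJ, of c] that(1) by (auto simp: j_def)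
    then show ?thesis using that by (auto simp: J_def)
  qed
  \<comment> \<open>Suppose column \<open>j\<close> were full down to row \<open>i - 1\<close>. Its
    pipe \<open>z\<close> would cross \<open>x\<close> in row \<open>r\<close> of
    \<open>D\<^sub>1\<close>, a maximal entry. In \<open>D\<^sub>2\<close> the left bump of
    \<open>z\<close> in row \<open>i\<close> then forces the crossing to lie above row
    \<open>i\<close>, but there \<open>z\<close> and \<open>x\<close> run down columns
    \<open>j\<close> and \<open>k\<close> and cannot meet.\<close>
  have "\<exists>s. r \<le> s \<and> s < i \<and> (s, j) \<notin> D\<^sub>2"
  proof (rule ccontr)
    assume "\<not> ?thesis"
    then have col_j: "(s, j) \<in> D\<^sub>2" if "r \<le> s" "s < i" for s
      using that by blast
    then have "(i, j) \<notin> D\<^sub>2" using j(2) by (metis le_neq_implies_less)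
    have "1 \<le> j" using pd2 col_j[of r] i(1) by (auto simp: pipe_dream_def)
    define z where "z = pipe_top D\<^sub>1 r j"
    have rj: "(r, j) \<in> D\<^sub>1" using k_least[of j] col_j[of r] i(1) j(1) by simp
    have "next_bump D\<^sub>1 r j = k"
      using j(1) k(2) k_least mid[of _ r] i(1) by (intro next_bump_eqI) auto
    then have "pipe_right D\<^sub>1 r j = x" using x1 by (simp add: pipe_right_def)
    then have zx: "(z, x) \<in> inversions (inv w)" "crossing D\<^sub>1 z x = (r, j)"
      using RPD_crossing[OF w D1 rj] by (auto simp: z_def)
    obtain s c where sc: "(s, c) \<in> D\<^sub>2" "pipe_top D\<^sub>2 s c = z" "pipe_right D\<^sub>2 s c = x"
        "crossing D\<^sub>2 z x = (s, c)"
      using RPD_crossing_exists[OF w D2 zx(1)] .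
    have "r \<le> s" using crossing_agree[OF zx(1)] zx(2) sc(4) by simp
    have top_j: "pipe_top D\<^sub>2 t j = z" if "r \<le> t" "t \<le> i" for t
    proof -
      have "pipe_top D\<^sub>2 t j = pipe_top D\<^sub>2 r j"
        using that col_j by (intro pipe_top_column) auto
      then show ?thesis using top_agree[of r j] by (simp add: z_def)
    qed
    have "i \<in> bump_rows D\<^sub>2 z"
      using \<open>(i, j) \<notin> D\<^sub>2\<close> \<open>1 \<le> j\<close> top_j[of i] i(1) by (auto simp: bump_rows_iff[OF pd2])
    have "s < i"
    proof (rule ccontr)
      assume "\<not> s < i"
      then have "bumps_below D\<^sub>2 z x < bumps_below D\<^sub>1 z x"
        using lt2[OF zx(1), of i] \<open>i \<in> bump_rows D\<^sub>2 z\<close> i(1) sc(4) row_max[OF rj] \<open>pipe_right D\<^sub>1 r j = x\<close>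
        by (simp add: z_def)
      then show False using le[OF zx(1)] by simp
    qed
    then have "pipe_top D\<^sub>2 s c = pipe_top D\<^sub>2 s j" "pipe_top D\<^sub>2 s (next_bump D\<^sub>2 s c) = pipe_top D\<^sub>2 s k"
      using top_j[of s] top_k[of s] \<open>r \<le> s\<close> sc by (auto simp: pipe_right_def)
    then have "next_bump D\<^sub>2 s c = k"
      using pipe_top_eq_iff[OF pd2] r1 \<open>r \<le> s\<close> by (meson le_trans)
    then show False using next_bump(2)[OF fin2, of s c] col_k[OF \<open>r \<le> s\<close> \<open>s < i\<close>] by simp
  qed
  then have H: "{s. r \<le> s \<and> s < i \<and> (s, j) \<notin> D\<^sub>2} \<noteq> {}" by blast
  define h where "h = Max {s. r \<le> s \<and> s < i \<and> (s, j) \<notin> D\<^sub>2}"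
  have finH: "finite {s. r \<le> s \<and> s < i \<and> (s, j) \<notin> D\<^sub>2}" by simp
  have h: "r \<le> h" "h < i" "(h, j) \<notin> D\<^sub>2" using Max_in[OF finH H] by (auto simp: h_def)
  have col_j: "(s, j) \<in> D\<^sub>2" if "h < s" "s < i" for s
  proof (rule ccontr)
    assume "(s, j) \<notin> D\<^sub>2"
    then have "s \<le> h" unfolding h_def using that h(1) by (intro Max_ge[OF finH]) simp
    then show False using that by simp
  qed
  \<comment> \<open>With \<open>j = 0\<close>, pipe \<open>x\<close> would exit in row
    \<open>r\<close> of \<open>D\<^sub>1\<close>, whereas in \<open>D\<^sub>2\<close> it passes row
    \<open>r\<close> vertically at \<open>(r, k)\<close>; yet \<open>w r\<close> exits there in
    both.\<close>
  have "1 \<le> j"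
  proof (rule ccontr)
    assume "\<not> 1 \<le> j"
    then have "j = 0" by simp
    then have "next_bump D\<^sub>1 r 0 = k"
      using k(2) k_least mid[of _ r] i(1) \<open>1 \<le> k\<close> by (intro next_bump_eqI) auto
    then have "pipe_top D\<^sub>1 (Suc r) 0 = pipe_top D\<^sub>2 r k"
      using pipe_dream_no_zero[OF pd1] x1 by (simp add: source_def x_def)
    moreover have "pipe_top D\<^sub>2 (Suc r) 0 = pipe_top D\<^sub>2 r (next_bump D\<^sub>2 r 0)"
      using pipe_dream_no_zero[OF pd2] by (simp add: source_def)
    ultimately have "next_bump D\<^sub>2 r 0 = k"
      using RPD_D(2)[OF D1 r1] RPD_D(2)[OF D2 r1] pipe_top_eq_iff[OF pd2 r1] by metis
    then show False using next_bump(2)[OF fin2, of r 0] k(1) by simp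
  qed
  \<comment> \<open>A cross at \<open>(i, j)\<close> would let \<open>x\<close> and the pipe of
    column \<open>j\<close> cross twice, with exchanged roles, at \<open>(h, k)\<close> and
    \<open>(i, j)\<close>.\<close>
  have "(i, j) \<notin> D\<^sub>2"
  proof
    assume ij: "(i, j) \<in> D\<^sub>2"
    have hk: "(h, k) \<in> D\<^sub>2" using col_k h by blast
    have "next_bump D\<^sub>2 i j = k"
      using j(1) i mid[of _ i] by (intro next_bump_eqI) auto
    then have "pipe_right D\<^sub>2 i j = x" using top_k[of i] i(1) by (simp add: pipe_right_def)
    moreover have "(h, c) \<in> D\<^sub>2" if "j < c" "c \<le> k" for c
      using that mid[of c h] h hk by (cases "c = k") auto
    then have "next_bump D\<^sub>2 h j = next_bump D\<^sub>2 h k"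
      using j(1) fin2 by (intro next_bump_skip) auto
    then have "pipe_right D\<^sub>2 h k = pipe_top D\<^sub>2 (Suc h) j"
      using pipe_top_Suc_bump[OF h(3)] by (simp add: pipe_right_def)
    moreover have "pipe_top D\<^sub>2 i j = pipe_top D\<^sub>2 (Suc h) j"
      using h col_j by (intro pipe_top_column) auto
    ultimately have "(pipe_top D\<^sub>2 i j, x) \<in> inversions (inv w)" "(x, pipe_top D\<^sub>2 i j) \<in> inversions (inv w)"
      using RPD_crossing(1)[OF w D2 ij] RPD_crossing(1)[OF w D2 hk] top_k[of h] h by auto
    then show False by (auto simp: inversions_def)
  qed
  define A where "A = insert (i, j) (D\<^sub>2 - {(h, k)})"
  have hk: "(h, k) \<in> D\<^sub>2" using col_k h by blast
  have rect: "ladder_rectangle A D\<^sub>2 h i j k"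
  proof
    show "pipe_dream A" using pd2 \<open>1 \<le> j\<close> i(1) by (auto simp: A_def pipe_dream_def)
    show "1 \<le> h" "h < i" "1 \<le> j" "j < k" using r1 h \<open>1 \<le> j\<close> j(1) by auto
    show "(i, j) \<in> A" "(h, j) \<notin> A" "(i, k) \<notin> A" "(h, k) \<notin> A"
      using h i j(1) by (auto simp: A_def)
    show "D\<^sub>2 = insert (h, k) (A - {(i, j)})"
      using hk \<open>(i, j) \<notin> D\<^sub>2\<close> h by (auto simp: A_def)
    show "{h..i} \<times> {j..k} - {(i, j), (h, j), (i, k), (h, k)} \<subseteq> A"
    proof (rule subsetI)
      fix p assume "p \<in> {h..i} \<times> {j..k} - {(i, j), (h, j), (i, k), (h, k)}"
      then obtain s c where p: "p = (s, c)" and sc: "s \<in> {h..i}" "c \<in> {j..k}"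
          "(s, c) \<notin> {(i, j), (h, j), (i, k), (h, k)}"
        by blast
      consider "c = j" | "c = k" | "j < c" "c < k" using sc(2) by fastforce
      then have "(s, c) \<in> A"
      proof cases
        case 1
        then show ?thesis using sc col_j[of s] j(1) by (cases "s = h"; cases "s = i") (auto simp: A_def)
      next
        case 2
        then show ?thesis using sc col_k[of s] h(1) by (cases "s = h"; cases "s = i") (auto simp: A_def)
      next
        case 3
        then show ?thesis using sc mid[of c s] h(1) by (auto simp: A_def)
      qed
      then show "p \<in> A" using p by simp
    qed
  qed
  interpret ladder_rectangle A "D\<^sub>2" h i j k by (fact rect)
  have A: "A \<in> RPD w" using RPD_iff D2 by simp
  \<comment> \<open>The labels in row \<open>h\<close> are not exchanged, so \<open>P\<close>,
    defined through \<open>A\<close>, can be read off from \<open>D\<^sub>2\<close>.\<close>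
  have "P = x" using pipe_top_B[of h k] top_k[of h] h by simp
  have "ladder_move w A D\<^sub>2"
    unfolding ladder_move_def using A bounds corners full B by blast
  moreover have "sum snd A < sum snd D\<^sub>2"
    using sum.remove[OF fin2 hk, of snd] \<open>(i, j) \<notin> D\<^sub>2\<close> fin2 j(1) by (simp add: A_def)
  moreover have "bumps_below D\<^sub>1 a b \<le> bumps_below A a b" if ab: "(a, b) \<in> inversions (inv w)" for a b
  proof (rule ccontr)
    assume less: "\<not> ?thesis"
    then have bb: "bumps_below D\<^sub>2 a b = Suc (bumps_below A a b)" "a = x"
        "h \<le> fst (crossing D\<^sub>2 a b)" "fst (crossing D\<^sub>2 a b) < i"
      using bumps_below_B[OF w A ab] le[OF ab] \<open>P = x\<close> by auto
    have "bumps_below D\<^sub>2 a b = card {s \<in> bump_rows D\<^sub>2 a. r \<le> s}"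
    proof (rule bumps_below_eq_from[OF pd2])
      show "r \<le> fst (crossing D\<^sub>2 a b)" using bb(3) h(1) by simp
      show "t \<notin> bump_rows D\<^sub>2 a" if "r \<le> t" "t \<le> fst (crossing D\<^sub>2 a b)" for t
        using no_bump_row[OF pd2 col_k[of t]] top_k[of t] that bb(2,4) by simp
    qed
    also have "\<dots> = card {s \<in> bump_rows D\<^sub>1 a. r \<le> s}"
      using card_from[of a] ab by (simp add: inversions_def)
    also have "\<dots> > bumps_below D\<^sub>1 a b"
    proof (rule lt1[OF ab order_refl])
      show "r \<le> fst (crossing D\<^sub>1 a b)" using crossing_agree[OF ab] bb(3) h(1) by simp
      show "r \<in> bump_rows D\<^sub>1 a"
        using r1 k(2) x1 \<open>1 \<le> k\<close> bb(2) by (auto simp: bump_rows_iff[OF pd1])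
    qed
    finally show False using bb(1) less by simp
  qed
  ultimately show ?thesis by blast
qed

theorem theorem1p3:
  fixes n :: nat and w :: "nat \<Rightarrow> nat" and D\<^sub>1 D\<^sub>2 :: "cell set"
  assumes "w permutes {1..n}"
    and "D\<^sub>1 \<in> RPD w" and "D\<^sub>2 \<in> RPD w"
  shows "ladder_le w D\<^sub>1 D\<^sub>2 \<longleftrightarrow> tableau_le w (pd_tableau w D\<^sub>1) (pd_tableau w D\<^sub>2)"
proof
  assume "ladder_le w D\<^sub>1 D\<^sub>2"
  then show "tableau_le w (pd_tableau w D\<^sub>1) (pd_tableau w D\<^sub>2)"
    using ladder_le_imp_bumps_below_le[OF assms(1) _ assms(2)] tableau_le_iff[OF assms(1)] by blast
next
  assume "tableau_le w (pd_tableau w D\<^sub>1) (pd_tableau w D\<^sub>2)"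
  then show "ladder_le w D\<^sub>1 D\<^sub>2"
    using assms(3)
  \<comment> \<open>The column sum of the crosses decreases with each inverse move, which shifts one
    cross to the left.\<close>
  proof (induction "sum snd D\<^sub>2" arbitrary: D\<^sub>2 rule: less_induct)
    case less
    show ?case
    proof (cases "D\<^sub>1 = D\<^sub>2")
      case True
      then show ?thesis by (simp add: ladder_le_def)
    next
      case False
      have "bumps_below D\<^sub>1 x y \<le> bumps_below D\<^sub>2 x y" if "(x, y) \<in> inversions (inv w)" for x y
        using less.prems(1) that tableau_le_iff[OF assms(1)] by blast
      then obtain A where A: "ladder_move w A D\<^sub>2" "sum snd A < sum snd D\<^sub>2"
          "\<forall>(x, y)\<in>inversions (inv w). bumps_below D\<^sub>1 x y \<le> bumps_below A x y"
        using inverse_ladder_move_exists[OF assms(1,2) less.prems(2) False] by blast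
      then have "ladder_le w D\<^sub>1 A"
        using less.hyps[of A] tableau_le_iff[OF assms(1)] by (simp add: ladder_move_def)
      then show ?thesis
        using A(1) unfolding ladder_le_def by (rule rtranclp.rtrancl_into_rtrancl)
    qed
  qed
qed

end
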